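(* Suppose $p_1=0$. Fix $D\in\mathbb N$ with $D\ge3$ and $p_D>0$, and fix $q_D\in(0,p_D]$. Let $E^{n,\varepsilon}$ denote the event that the configuration model $G([n],\boldsymbol d(n))$ has a connected component that is $D$-regular (all its vertices have degree $D$) and whose number of vertices $N_D$ lies in $[n(q_D-\varepsilon),n(q_D+\varepsilon)]$. Then $$\lim\star_{\varepsilon\to0}\ \lim\star_{n\to\infty}\frac1n\log P\{E^{n,\varepsilon}\}=-\big(q_D\log q_D+(p_D-q_D)\log(p_D-q_D)-p_D\log p_D\big)$$ $$\qquad+\Big(\frac{Dq_D}{2}\log\frac{Dq_D}{2}+\frac{\mu-Dq_D}{2}\log\frac{\mu-Dq_D}{2}-\frac\mu2\log\frac\mu2\Big),$$ where $\mu=\sum_{k=1}^\infty kp_k$ and each $\lim\star$ stands for either $\limsup$ or $\liminf$ (the equality holds for every choice).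
   Context: Configuration model. For each $n\in\mathbb N$, $\boldsymbol d(n)=(d_1,\dots,d_n)$ (depending on $n$) is a sequence of strictly positive integers with even sum. $G([n],\boldsymbol d(n))$ is the random multigraph on $[n]=\{1,\dots,n\}$ obtained by attaching $d_i$ half-edges to vertex $i$ and taking a uniformly random perfect matching of all half-edges, each matched pair forming an edge (self-loops and multiple edges allowed). The degree of vertex $i$ is $d_i$. Let $n_k=|\{i\in[n]:d_i=k\}|$ (depending on $n$). Assumptions: (1) there is a probability distribution $\boldsymbol p=(p_k)_{k\in\mathbb N}$ on $\mathbb N$ with $n_k/n\to p_k$ as $n\to\infty$ for every $k\in\mathbb N$; (2) there is $\varepsilon_{\boldsymbol p}\in(0,\infty)$ with $\sup_{n}\sum_{k=1}^\infty\frac{n_k}{n}k^{1+\varepsilon_{\boldsymbol p}}<\infty$ (so $\mu<\infty$). Convention: $0\log0=0$. *)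

theory Defs
  imports "HOL-Probability.Probability" "HOL-Library.Multiset" "HOL-Library.Disjoint_Sets"
begin

text \<open>The pair \<open>(i, j)\<close> is the \<open>j\<close>-th half-edge attached to vertex \<open>i\<close>.\<close>

definition half_edges :: "nat \<Rightarrow> (nat \<Rightarrow> nat) \<Rightarrow> (nat \<times> nat) set" where
  "half_edges n d = (SIGMA i:{1..n}. {1..d i})"

definition perfect_matchings :: "'a set \<Rightarrow> 'a set set set" where
  "perfect_matchings H = {M. partition_on H M \<and> (\<forall>e\<in>M. card e = 2)}"

text \<open>
  A multigraph on a given vertex set is represented by its multiset of edges. An edge
  joining \<open>u\<close> and \<open>v\<close> is the set \<open>{u, v}\<close> of its endpoints, so a self-loop at \<open>v\<close> is
  the singleton \<open>{v}\<close>.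
\<close>

type_synonym 'v multigraph = "'v set multiset"

definition graph_of_matching :: "('v \<times> 'b) set set \<Rightarrow> 'v multigraph" where
  "graph_of_matching M = image_mset (\<lambda>e. fst ` e) (mset_set M)"

definition configuration_model :: "nat \<Rightarrow> (nat \<Rightarrow> nat) \<Rightarrow> nat multigraph pmf" where
  "configuration_model n d =
     map_pmf graph_of_matching (pmf_of_set (perfect_matchings (half_edges n d)))"

text \<open>A self-loop contributes two to the degree of its vertex.\<close>

definition mdegree :: "'v multigraph \<Rightarrow> 'v \<Rightarrow> nat" where
  "mdegree G v = size {#e \<in># G. v \<in> e#} + count G {v}"

definition adjacency :: "'v multigraph \<Rightarrow> ('v \<times> 'v) set" where
  "adjacency G = {(u, v). {u, v} \<in># G}"

definition connected_components :: "'v set \<Rightarrow> 'v multigraph \<Rightarrow> 'v set set" where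
  "connected_components V G = V // {(u, v) \<in> V \<times> V. (u, v) \<in> (adjacency G)\<^sup>*}"

definition degree_count :: "nat \<Rightarrow> (nat \<Rightarrow> nat) \<Rightarrow> nat \<Rightarrow> nat" where
  "degree_count n d k = card {i \<in> {1..n}. d i = k}"

definition regular_component_event ::
  "nat \<Rightarrow> nat \<Rightarrow> real \<Rightarrow> real \<Rightarrow> nat multigraph set" where
  "regular_component_event n D q \<epsilon> =
     {G. \<exists>C \<in> connected_components {1..n} G.
           (\<forall>v\<in>C. mdegree G v = D) \<and>
           real (card C) \<in> {real n * (q - \<epsilon>)..real n * (q + \<epsilon>)}}"

text \<open>
  Logarithm of a probability with \<open>log 0 = -\<infinity>\<close>; the library's real-valued \<^term>\<open>ln\<close>
  has \<open>ln 0 = 0\<close>.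
\<close>

definition ext_ln :: "real \<Rightarrow> ereal" where
  "ext_ln x = (if x > 0 then ereal (ln x) else -\<infinity>)"

end

theory Submission
  imports Defs "HOL-Real_Asymp.Real_Asymp"
begin

text \<open>
  A vertex set \<open>C\<close> is \<^emph>\<open>closed\<close> for a matching of the half-edges if no pair has exactly one
  half-edge at \<open>C\<close>. Components are precisely the minimal nonempty closed sets, and closed sets are
  easy to count: a matching for which \<open>C\<close> is closed is a matching of the half-edges at \<open>C\<close>
  together with a matching of all others. Write \<open>s\<close> for the number of vertices of degree \<open>D\<close>,
  \<open>T\<close> for the number of half-edges and \<open>m(k)\<close> for the number of perfect matchings of \<open>k\<close> points.
  The expected number of closed \<open>D\<close>-regular sets with \<open>N\<close> vertices is then
  \<open>(s choose N) m(D N) m(T - D N) / m(T)\<close>, and the exponential rate of this number is the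
  claimed limit.

  Upper bound: by the union bound, the probability of the event is at most the sum of these
  expectations over the at most \<open>n + 1\<close> sizes \<open>N\<close> in the window
  (\<open>regular_component_prob_le\<close>).

  Lower bound: for a single size \<open>N\<close> the number of components with \<open>N\<close> vertices has expectation at
  most \<open>n\<close> times the probability that there is one (\<open>regular_component_prob_ge\<close>). It remains to
  see that a closed \<open>D\<close>-regular set is connected with probability bounded below. For \<open>D \<ge> 3\<close>
  the expected number of closed subsets with \<open>k\<close> vertices of a random \<open>D\<close>-regular multigraph on
  \<open>N\<close> vertices is at most \<open>(N choose k) powr (- 1 / 2)\<close>, and the sum of this over
  \<open>0 < k < N\<close> vanishes as \<open>N\<close> grows (\<open>eventually_half_connected\<close>). A suitable size is an even
  \<open>N \<le> s\<close> with \<open>N / n\<close> tending to \<open>q\<close>.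

  Asymptotics: since \<open>m(2 a) m(2 b) / m(2 (a + b)) = (a + b choose a) / (2 (a + b) choose 2 a)\<close>,
  only binomial coefficients occur. A crude form of Stirling's formula turns the expectation into
  \<open>exp (n R + O(ln n))\<close>, where \<open>R\<close> depends only on \<open>s / n\<close>, \<open>T / n\<close> and \<open>N / n\<close>
  (\<open>expected_closed_approx\<close>). As \<open>R\<close> is continuous, the limits \<open>s / n \<rightarrow> p\<^sub>D\<close> and
  \<open>T / n \<rightarrow> \<mu>\<close> give the theorem; the second one holds because the moment bound makes the degrees
  uniformly integrable (\<open>mean_degree_tendsto\<close>).
\<close>

section \<open>Perfect matchings\<close>

definition matching_closed :: "'a set set \<Rightarrow> 'a set \<Rightarrow> bool" where
  "matching_closed M A \<longleftrightarrow> (\<forall>e\<in>M. e \<subseteq> A \<or> e \<inter> A = {})"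

lemma perfect_matchings_subset: "M \<in> perfect_matchings H \<Longrightarrow> e \<in> M \<Longrightarrow> e \<subseteq> H"
  unfolding perfect_matchings_def partition_on_def by blast

lemma perfect_matchings_disjoint:
  "M \<in> perfect_matchings H \<Longrightarrow> e \<in> M \<Longrightarrow> e' \<in> M \<Longrightarrow> e \<noteq> e' \<Longrightarrow> e \<inter> e' = {}"
  unfolding perfect_matchings_def partition_on_def disjoint_def by blast

lemma perfect_matchings_cover:
  assumes "M \<in> perfect_matchings H" "h \<in> H"
  obtains e where "e \<in> M" "h \<in> e" "card e = 2"
  using assms unfolding perfect_matchings_def partition_on_def by blast

lemma finite_perfect_matchings: "finite H \<Longrightarrow> finite (perfect_matchings H)"
  by (rule finite_subset[of _ "Pow (Pow H)"]) (use perfect_matchings_subset in blast, simp)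

lemma finite_perfect_matching:
  assumes "finite H" "M \<in> perfect_matchings H"
  shows "finite M"
proof (rule finite_subset)
  show "M \<subseteq> Pow H" using perfect_matchings_subset[OF assms(2)] by blast
qed (use assms in simp)

lemma perfect_matchings_card_even:
  assumes "finite H" "M \<in> perfect_matchings H"
  shows "even (card H)"
proof -
  have "card H = (\<Sum>e\<in>M. card e)"
  proof (rule product_partition)
    show "finite e" if "e \<in> M" for e
      using perfect_matchings_subset[OF assms(2) that] assms(1) finite_subset by blast
  qed (use assms in \<open>simp add: perfect_matchings_def\<close>)
  also have "\<dots> = (\<Sum>e\<in>M. 2)"
    using assms by (intro sum.cong) (auto simp: perfect_matchings_def)
  finally show ?thesis by simp
qed

text \<open>
  A matching for which \<open>A\<close> is closed falls apart into its pairs inside \<open>A\<close> and those outside;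
  conversely any two matchings of the two parts can be glued.
\<close>

lemma bij_betw_split_matching:
  assumes "A \<subseteq> H"
  shows "bij_betw (\<lambda>M. (M \<inter> Pow A, M \<inter> Pow (H - A)))
    {M \<in> perfect_matchings H. matching_closed M A}
    (perfect_matchings A \<times> perfect_matchings (H - A))"
proof (rule bij_betw_byWitness[where f' = "\<lambda>(M1, M2). M1 \<union> M2"])
  show "\<forall>M\<in>{M \<in> perfect_matchings H. matching_closed M A}.
      (case (M \<inter> Pow A, M \<inter> Pow (H - A)) of (M1, M2) \<Rightarrow> M1 \<union> M2) = M"
    using perfect_matchings_subset by (fastforce simp: matching_closed_def)
  show "\<forall>x\<in>perfect_matchings A \<times> perfect_matchings (H - A).
      (\<lambda>M. (M \<inter> Pow A, M \<inter> Pow (H - A))) (case x of (M1, M2) \<Rightarrow> M1 \<union> M2) = x"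
  proof safe
    fix M1 M2 e
    assume M: "M1 \<in> perfect_matchings A" "M2 \<in> perfect_matchings (H - A)"
    {
      assume e: "e \<in> M2" "e \<subseteq> A"
      then have "e \<noteq> {}" "e \<subseteq> H - A"
        using M by (auto simp: perfect_matchings_def partition_on_def)
      with e show "e \<in> M1" by blast
    next
      assume e: "e \<in> M1" "e \<subseteq> H - A"
      then have "e \<noteq> {}" "e \<subseteq> A"
        using M by (auto simp: perfect_matchings_def partition_on_def)
      with e show "e \<in> M2" by blast
    }
  qed (auto dest: perfect_matchings_subset)
  show "(\<lambda>M. (M \<inter> Pow A, M \<inter> Pow (H - A))) ` {M \<in> perfect_matchings H. matching_closed M A}
      \<subseteq> perfect_matchings A \<times> perfect_matchings (H - A)"
  proof safe
    fix M
    assume M: "M \<in> perfect_matchings H" "matching_closed M A"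
    have restrict: "M \<inter> Pow B \<in> perfect_matchings B"
      if "B \<subseteq> H" "matching_closed M B" for B
    proof -
      have "\<Union> (M \<inter> Pow B) = B"
      proof (rule antisym)
        show "B \<subseteq> \<Union> (M \<inter> Pow B)"
        proof
          fix x
          assume "x \<in> B"
          with M that obtain e where "e \<in> M" "x \<in> e"
            by (auto simp: perfect_matchings_def partition_on_def)
          with \<open>x \<in> B\<close> that show "x \<in> \<Union> (M \<inter> Pow B)"
            by (auto simp: matching_closed_def)
        qed
      qed auto
      with M show ?thesis
        by (auto simp: perfect_matchings_def partition_on_def disjoint_def)
    qed
    show "M \<inter> Pow A \<in> perfect_matchings A"
      using M assms by (intro restrict)
    have "matching_closed M (H - A)"
      using M perfect_matchings_subset[OF M(1)] unfolding matching_closed_def by blast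
    then show "M \<inter> Pow (H - A) \<in> perfect_matchings (H - A)"
      by (intro restrict) auto
  qed
  show "(\<lambda>(M1, M2). M1 \<union> M2) ` (perfect_matchings A \<times> perfect_matchings (H - A))
      \<subseteq> {M \<in> perfect_matchings H. matching_closed M A}"
  proof safe
    fix M1 M2
    assume M: "M1 \<in> perfect_matchings A" "M2 \<in> perfect_matchings (H - A)"
    have "partition_on (A \<union> (H - A)) (M1 \<union> M2)"
    proof (rule partition_onI)
      show "disjnt e e'" if "e \<in> M1 \<union> M2" "e' \<in> M1 \<union> M2" "e \<noteq> e'" for e e'
      proof (cases "(e \<in> M1 \<and> e' \<in> M1) \<or> (e \<in> M2 \<and> e' \<in> M2)")
        case True
        with M that show ?thesis
          unfolding perfect_matchings_def partition_on_def disjoint_def disjnt_def by blast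
      next
        case False
        with that have "(e \<subseteq> A \<and> e' \<subseteq> H - A) \<or> (e' \<subseteq> A \<and> e \<subseteq> H - A)"
          using perfect_matchings_subset[OF M(1)] perfect_matchings_subset[OF M(2)] by blast
        then show ?thesis unfolding disjnt_def by blast
      qed
    qed (use M in \<open>auto simp: perfect_matchings_def partition_on_def\<close>)
    moreover have "A \<union> (H - A) = H" using assms by auto
    ultimately show "M1 \<union> M2 \<in> perfect_matchings H"
      using M by (auto simp: perfect_matchings_def)
    show "matching_closed (M1 \<union> M2) A"
      using perfect_matchings_subset[OF M(1)] perfect_matchings_subset[OF M(2)]
      unfolding matching_closed_def by blast
  qed
qed

text \<open>
  The condition \<open>P\<close> on the part inside \<open>A\<close> makes it possible to count matchings for which this part is
  connected.
\<close>

lemma card_matchings_split: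
  assumes "A \<subseteq> H"
  shows "card {M \<in> perfect_matchings H. matching_closed M A \<and> P (M \<inter> Pow A)} =
    card {M \<in> perfect_matchings A. P M} * card (perfect_matchings (H - A))"
proof -
  have "card {M \<in> perfect_matchings H. matching_closed M A \<and> P (M \<inter> Pow A)} =
      card {M \<in> {M \<in> perfect_matchings H. matching_closed M A}. P (M \<inter> Pow A)}"
    by (simp add: conj_assoc)
  also have "\<dots> = card {x \<in> perfect_matchings A \<times> perfect_matchings (H - A). P (fst x)}"
    by (rule bij_betw_same_card, rule bij_betw_Collect[OF bij_betw_split_matching[OF assms]]) simp
  also have "{x \<in> perfect_matchings A \<times> perfect_matchings (H - A). P (fst x)} =
      {M \<in> perfect_matchings A. P M} \<times> perfect_matchings (H - A)"
    by auto
  finally show ?thesis by (simp add: card_cartesian_product)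
qed

corollary card_matchings_closed:
  assumes "A \<subseteq> H"
  shows "card {M \<in> perfect_matchings H. matching_closed M A} =
    card (perfect_matchings A) * card (perfect_matchings (H - A))"
  using card_matchings_split[OF assms, of "\<lambda>_. True"] by simp

text \<open>
  This is the double factorial \<open>(k - 1)!!\<close> for even \<open>k\<close>.
\<close>

definition num_matchings :: "nat \<Rightarrow> nat" where
  "num_matchings k = (if even k then fact k div (2 ^ (k div 2) * fact (k div 2)) else 0)"

lemma perfect_matchings_pair:
  assumes "a \<noteq> b"
  shows "perfect_matchings {a, b} = {{{a, b}}}"
proof (intro equalityI subsetI)
  fix M
  assume M: "M \<in> perfect_matchings {a, b}"
  have "e = {a, b}" if "e \<in> M" for e
  proof (rule card_subset_eq)
    show "e \<subseteq> {a, b}" by (rule perfect_matchings_subset[OF M that])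
    have "card e = 2" using M that by (simp add: perfect_matchings_def)
    with assms show "card e = card {a, b}" by simp
  qed simp
  moreover have "M \<noteq> {}"
    using M unfolding perfect_matchings_def partition_on_def by blast
  ultimately show "M \<in> {{{a, b}}}" by blast
next
  fix M
  assume "M \<in> {{{a, b}}}"
  with assms show "M \<in> perfect_matchings {a, b}"
    by (simp add: perfect_matchings_def partition_on_def)
qed

text \<open>
  Reading membership of a pair as closedness of that pair lets the partner of a fixed point be
  removed by the splitting lemma.
\<close>

lemma closed_pair_iff:
  assumes M: "M \<in> perfect_matchings H" and ab: "a \<in> H" "a \<noteq> b"
  shows "matching_closed M {a, b} \<longleftrightarrow> {a, b} \<in> M"
proof
  assume c: "matching_closed M {a, b}"
  obtain e where e: "e \<in> M" "a \<in> e" "card e = 2"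
    using perfect_matchings_cover[OF M ab(1)] .
  with c have "e \<subseteq> {a, b}" unfolding matching_closed_def by blast
  moreover have "card e = card {a, b}" using e ab by simp
  ultimately have "e = {a, b}" by (intro card_subset_eq) auto
  with e show "{a, b} \<in> M" by simp
next
  assume "{a, b} \<in> M"
  then show "matching_closed M {a, b}"
    unfolding matching_closed_def using perfect_matchings_disjoint[OF M] by blast
qed

text \<open>
  Classify the matchings by the partner \<open>b\<close> of \<open>a\<close>.
\<close>

lemma card_perfect_matchings_step:
  assumes H: "finite H" "a \<in> H"
  shows "card (perfect_matchings H) =
    (\<Sum>b\<in>H - {a}. card (perfect_matchings (H - {a, b})))"
proof -
  let ?P = "\<lambda>b. {M \<in> perfect_matchings H. matching_closed M {a, b}}"
  have cover: "perfect_matchings H = (\<Union>b\<in>H - {a}. ?P b)"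
  proof (intro equalityI subsetI)
    fix M
    assume M: "M \<in> perfect_matchings H"
    then obtain e where e: "e \<in> M" "a \<in> e" "card e = 2"
      using perfect_matchings_cover H by metis
    then obtain b where b: "e = {a, b}" "a \<noteq> b"
      by (auto simp: card_2_iff)
    with M e H have "b \<in> H - {a}" "M \<in> ?P b"
      using perfect_matchings_subset[OF M e(1)] by (auto simp: closed_pair_iff)
    then show "M \<in> (\<Union>b\<in>H - {a}. ?P b)" by blast
  qed auto
  have disj: "?P b \<inter> ?P c = {}" if "b \<in> H - {a}" "c \<in> H - {a}" "b \<noteq> c" for b c
  proof (rule ccontr)
    assume "?P b \<inter> ?P c \<noteq> {}"
    then obtain M where PM: "M \<in> ?P b" "M \<in> ?P c" by blast
    then have M: "M \<in> perfect_matchings H" by blast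
    have "{a, b} \<in> M" "{a, c} \<in> M"
      using PM that closed_pair_iff[OF M H(2)] by auto
    then have "{a, b} = {a, c}" using perfect_matchings_disjoint[OF M] by blast
    with that show False by (simp add: doubleton_eq_iff)
  qed
  have "card (perfect_matchings H) = (\<Sum>b\<in>H - {a}. card (?P b))"
    by (subst cover, rule card_UN_disjoint) (use H disj finite_perfect_matchings[OF H(1)] in auto)
  also have "\<dots> = (\<Sum>b\<in>H - {a}. card (perfect_matchings (H - {a, b})))"
  proof (rule sum.cong)
    fix b
    assume "b \<in> H - {a}"
    with H show "card (?P b) = card (perfect_matchings (H - {a, b}))"
      by (subst card_matchings_closed) (auto simp: perfect_matchings_pair)
  qed simp
  finally show ?thesis .
qed

lemma perfect_matchings_empty: "perfect_matchings {} = {{}}"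
proof -
  have "M = {}" if "M \<in> perfect_matchings {}" for M :: "'a set set"
    using that unfolding perfect_matchings_def partition_on_def by auto
  moreover have "{} \<in> perfect_matchings ({} :: 'a set)"
    by (simp add: perfect_matchings_def partition_on_def)
  ultimately show ?thesis by blast
qed

lemma card_perfect_matchings_even:
  assumes "finite H" "card H = 2 * m"
  shows "card (perfect_matchings H) * (2 ^ m * fact m) = fact (2 * m)"
  using assms
proof (induction m arbitrary: H)
  case 0
  then show ?case by (simp add: perfect_matchings_empty)
next
  case (Suc m)
  then obtain a where a: "a \<in> H" by fastforce
  have *: "card (perfect_matchings (H - {a, b})) * (2 ^ m * fact m) = fact (2 * m)"
    if "b \<in> H - {a}" for b
    using Suc.prems a that by (intro Suc.IH) (auto simp: card_Diff_subset)
  have "card (perfect_matchings H) * (2 ^ m * fact m) = (\<Sum>b\<in>H - {a}. fact (2 * m))"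
    using * by (simp add: card_perfect_matchings_step[OF Suc.prems(1) a] sum_distrib_right)
  also have "\<dots> = (2 * m + 1) * fact (2 * m)"
    using Suc.prems a by simp
  finally have "card (perfect_matchings H) * (2 ^ m * fact m) = (2 * m + 1) * fact (2 * m)" .
  then have "card (perfect_matchings H) * (2 ^ m * fact m) * (2 * Suc m) =
      fact (2 * Suc m)"
    by (simp add: algebra_simps)
  then show ?case by (simp add: algebra_simps)
qed

lemma card_perfect_matchings:
  assumes "finite H"
  shows "card (perfect_matchings H) = num_matchings (card H)"
proof (cases "even (card H)")
  case True
  then obtain m where m: "card H = 2 * m" by (auto elim: evenE)
  have "card (perfect_matchings H) = card (perfect_matchings H) * (2 ^ m * fact m) div (2 ^ m * fact m)"
    by (rule nonzero_mult_div_cancel_right[symmetric]) simp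
  then show ?thesis
    unfolding card_perfect_matchings_even[OF assms m] by (simp add: m num_matchings_def)
next
  case False
  then have "perfect_matchings H = {}"
    using perfect_matchings_card_even[OF assms] by blast
  with False show ?thesis by (simp add: num_matchings_def)
qed

lemma real_num_matchings: "real (num_matchings (2 * m)) = fact (2 * m) / (2 ^ m * fact m)"
proof -
  have "num_matchings (2 * m) * (2 ^ m * fact m) = fact (2 * m)"
    using card_perfect_matchings_even[of "{..<2 * m}" m] card_perfect_matchings[of "{..<2 * m}"]
    by simp
  then have "real (num_matchings (2 * m) * (2 ^ m * fact m)) = real (fact (2 * m))"
    by (rule arg_cong)
  then have "real (num_matchings (2 * m)) * (2 ^ m * fact m) = fact (2 * m)"
    by (simp only: of_nat_mult of_nat_power of_nat_fact of_nat_numeral)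
  then show ?thesis by (simp add: nonzero_eq_divide_eq)
qed

lemma num_matchings_pos:
  assumes "even k"
  shows "num_matchings k > 0"
proof -
  obtain m where "k = 2 * m" using assms by (auto elim: evenE)
  then have "real (num_matchings k) > 0" by (simp add: real_num_matchings)
  then show ?thesis by simp
qed

text \<open>
  The powers of two in the matching numbers cancel. Expressing everything by binomial coefficients
  makes both the connectivity estimate and the asymptotics a matter of binomial coefficients.
\<close>

lemma num_matchings_ratio:
  "real (num_matchings (2 * a)) * real (num_matchings (2 * b)) / real (num_matchings (2 * (a + b))) =
   real (a + b choose a) / real (2 * (a + b) choose (2 * a))"
proof -
  have "2 * (a + b) - 2 * a = 2 * b" by simp
  then have b1: "real (2 * (a + b) choose (2 * a)) = fact (2 * (a + b)) / (fact (2 * a) * fact (2 * b))"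
    by (subst binomial_fact) simp_all
  have b2: "real (a + b choose a) = fact (a + b) / (fact a * fact b)"
    by (subst binomial_fact) simp_all
  show ?thesis
    unfolding real_num_matchings b1 b2 by (simp add: divide_simps power_add del: distrib_left_numeral)
qed

section \<open>Components of the multigraph of a matching\<close>

definition stubs :: "('v \<Rightarrow> nat) \<Rightarrow> 'v set \<Rightarrow> ('v \<times> nat) set" where
  "stubs d S = (SIGMA i:S. {1..d i})"

lemma half_edges_eq_stubs: "half_edges n d = stubs d {1..n}"
  by (simp add: half_edges_def stubs_def)

lemma stubs_mono: "S \<subseteq> T \<Longrightarrow> stubs d S \<subseteq> stubs d T"
  by (auto simp: stubs_def)

lemma stubs_Diff: "stubs d (S - T) = stubs d S - stubs d T"
  by (auto simp: stubs_def)

lemma finite_stubs: "finite S \<Longrightarrow> finite (stubs d S)"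
  by (auto simp: stubs_def)

lemma card_stubs: "finite S \<Longrightarrow> card (stubs d S) = (\<Sum>i\<in>S. d i)"
  by (simp add: stubs_def)

lemma graph_of_matching_edge_iff:
  assumes "finite M"
  shows "x \<in># graph_of_matching M \<longleftrightarrow> (\<exists>e\<in>M. x = fst ` e)"
  using assms by (auto simp: graph_of_matching_def)

text \<open>
  Each pair contributes to the degree of \<open>v\<close> the number of its half-edges at \<open>v\<close>; this is two
  exactly for a loop at \<open>v\<close>, in accordance with the convention for loops.
\<close>

lemma mdegree_graph_of_matching:
  assumes V: "finite V" and M: "M \<in> perfect_matchings (stubs d V)" and v: "v \<in> V"
  shows "mdegree (graph_of_matching M) v = d v"
proof -
  let ?Hv = "{h \<in> stubs d V. fst h = v}"
  have fin: "finite M" using finite_perfect_matching[OF finite_stubs[OF V] M] .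
  have fe: "finite e" if "e \<in> M" for e
    using that M by (auto simp: perfect_matchings_def intro: card_ge_0_finite)
  have "d v = card ({v} \<times> {1..d v})" by simp
  also have "{v} \<times> {1..d v} = ?Hv" using v by (auto simp: stubs_def)
  also have "?Hv = (\<Union>e\<in>M. e \<inter> {h. fst h = v})"
    using M by (auto simp: perfect_matchings_def partition_on_def)
  also have "card \<dots> = (\<Sum>e\<in>M. card (e \<inter> {h. fst h = v}))"
  proof (rule card_UN_disjoint)
    show "\<forall>e\<in>M. \<forall>e'\<in>M. e \<noteq> e' \<longrightarrow> (e \<inter> {h. fst h = v}) \<inter> (e' \<inter> {h. fst h = v}) = {}"
      using perfect_matchings_disjoint[OF M] by blast
  qed (use fin fe in auto)
  also have "\<dots> = (\<Sum>e\<in>M. (if v \<in> fst ` e then 1 else 0) + (if fst ` e = {v} then 1 else 0))"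
  proof (rule sum.cong)
    fix e
    assume "e \<in> M"
    then have "card e = 2" using M by (auto simp: perfect_matchings_def)
    then obtain h h' where e: "e = {h, h'}" "h \<noteq> h'" by (auto simp: card_2_iff)
    have "{h, h'} \<inter> {x. fst x = v} =
        (if fst h = v then {h} else {}) \<union> (if fst h' = v then {h'} else {})"
      by auto
    with e show "card (e \<inter> {h. fst h = v}) =
        (if v \<in> fst ` e then 1 else 0) + (if fst ` e = {v} then 1 else 0)"
      by auto
  qed simp
  also have "\<dots> = card {e \<in> M. v \<in> fst ` e} + card {e \<in> M. fst ` e = {v}}"
    using fin by (simp add: sum.distrib flip: sum.inter_filter)
  also have "card {e \<in> M. v \<in> fst ` e} = size {#e \<in># graph_of_matching M. v \<in> e#}"
    using fin by (simp add: graph_of_matching_def filter_mset_image_mset)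
  also have "card {e \<in> M. fst ` e = {v}} = count (graph_of_matching M) {v}"
  proof -
    have "{e \<in> M. fst ` e = {v}} = {e \<in> M. {v} = fst ` e}" by auto
    then show ?thesis
      using fin by (simp add: graph_of_matching_def count_image_mset' flip: sum.inter_filter)
  qed
  finally show ?thesis by (simp add: mdegree_def)
qed

lemma card_connected_components_le:
  assumes V: "finite V"
  shows "card (connected_components V G) \<le> card V"
proof -
  have "connected_components V G =
      (\<lambda>x. {(u, v) \<in> V \<times> V. (u, v) \<in> (adjacency G)\<^sup>*} `` {x}) ` V"
    by (auto simp: connected_components_def quotient_def)
  then show ?thesis using V by (simp add: card_image_le)
qed

lemma finite_connected_components: "finite V \<Longrightarrow> finite (connected_components V G)"
  by (auto simp: connected_components_def quotient_def)

context
  fixes V :: "'v set" and d :: "'v \<Rightarrow> nat" and M :: "('v \<times> nat) set set"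
  assumes V: "finite V" and M: "M \<in> perfect_matchings (stubs d V)"
begin

lemma adjacency_iff:
  "(u, v) \<in> adjacency (graph_of_matching M) \<longleftrightarrow> (\<exists>e\<in>M. fst ` e = {u, v})"
  using graph_of_matching_edge_iff[OF finite_perfect_matching[OF finite_stubs[OF V] M], of "{u, v}"]
  unfolding adjacency_def by (simp add: eq_commute)

lemma component_closed:
  assumes C: "C \<in> connected_components V (graph_of_matching M)"
  shows "matching_closed M (stubs d C)"
proof -
  let ?R = "{(u, v) \<in> V \<times> V. (u, v) \<in> (adjacency (graph_of_matching M))\<^sup>*}"
  obtain x where C: "C = ?R `` {x}" "x \<in> V"
    using C by (auto simp: connected_components_def quotient_def)
  have "h' \<in> stubs d C" if "e \<in> M" "h \<in> e" "h' \<in> e" "h \<in> stubs d C" for e h h'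
  proof (cases "h = h'")
    case False
    have h': "h' \<in> stubs d V" using M that perfect_matchings_subset by blast
    have "card e = 2" using M that by (auto simp: perfect_matchings_def)
    with that False have "e = {h, h'}" by (auto simp: card_2_iff)
    with that have "(fst h, fst h') \<in> adjacency (graph_of_matching M)"
      by (auto simp: adjacency_iff intro!: bexI[of _ e])
    moreover have "(x, fst h) \<in> ?R" using that C by (auto simp: stubs_def)
    ultimately have "(x, fst h') \<in> ?R"
      using h' by (auto simp: stubs_def intro: rtrancl_into_rtrancl)
    with h' C show ?thesis by (auto simp: stubs_def)
  qed (use that in simp)
  then show ?thesis unfolding matching_closed_def by blast
qed

text \<open>
  The component of a vertex of \<open>C\<close> cannot leave the closed set \<open>C\<close>; being itself closed, it must
  be all of \<open>C\<close> by minimality.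
\<close>

lemma minimal_closed_component:
  assumes C: "C \<subseteq> V" "C \<noteq> {}" "matching_closed M (stubs d C)"
    and minimal: "\<And>S. S \<noteq> {} \<Longrightarrow> S \<subset> C \<Longrightarrow> \<not> matching_closed M (stubs d S)"
  shows "C \<in> connected_components V (graph_of_matching M)"
proof -
  let ?R = "{(u, v) \<in> V \<times> V. (u, v) \<in> (adjacency (graph_of_matching M))\<^sup>*}"
  obtain x where x: "x \<in> C" using C by auto
  let ?K = "?R `` {x}"
  have K: "?K \<in> connected_components V (graph_of_matching M)"
    unfolding connected_components_def by (rule quotientI) (use x C in blast)
  have "v \<in> C" if "(x, v) \<in> (adjacency (graph_of_matching M))\<^sup>*" for v
    using that
  proof (induction rule: rtrancl_induct)
    case (step u v)
    then obtain e where e: "e \<in> M" "fst ` e = {u, v}" by (auto simp: adjacency_iff)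
    then obtain h h' where h: "h \<in> e" "fst h = u" "h' \<in> e" "fst h' = v"
      by (metis imageE insertI1 insert_commute)
    have "h \<in> stubs d V" using e h M perfect_matchings_subset by blast
    with h step.IH have "h \<in> stubs d C" by (auto simp: stubs_def)
    with e h C have "h' \<in> stubs d C" unfolding matching_closed_def by blast
    with h show "v \<in> C" by (auto simp: stubs_def)
  qed (use x in simp)
  then have "?K \<subseteq> C" by auto
  moreover have "?K \<noteq> {}" using x C by auto
  ultimately have "?K = C"
    using minimal[of ?K] component_closed[OF K] by blast
  with K show ?thesis by simp
qed

end

section \<open>Counting closed and connected regular vertex sets\<close>

definition matching_connected :: "('v \<Rightarrow> nat) \<Rightarrow> 'v set \<Rightarrow> ('v \<times> nat) set set \<Rightarrow> bool" where
  "matching_connected d C M \<longleftrightarrow> (\<forall>S. S \<noteq> {} \<longrightarrow> S \<subset> C \<longrightarrow> \<not> matching_closed M (stubs d S))"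

lemma matching_closed_restrict:
  assumes "matching_closed M A" "B \<subseteq> A"
  shows "matching_closed (M \<inter> Pow A) B \<longleftrightarrow> matching_closed M B"
  using assms unfolding matching_closed_def by blast

lemma card_regular_stubs:
  assumes "finite S" "\<And>i. i \<in> S \<Longrightarrow> d i = D"
  shows "card (stubs d S) = D * card S"
  using assms by (simp add: card_stubs)

text \<open>
  The number of ways to match \<open>k\<close> given half-edges among themselves and the other \<open>T - k\<close> among
  themselves.
\<close>

definition split_weight :: "nat \<Rightarrow> nat \<Rightarrow> nat" where
  "split_weight T k = num_matchings k * num_matchings (T - k)"

lemma card_matchings_outside:
  assumes V: "finite V" and C: "C \<subseteq> V" "\<And>i. i \<in> C \<Longrightarrow> d i = D"
  shows "card (perfect_matchings (stubs d V - stubs d C)) = num_matchings (sum d V - D * card C)"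
proof -
  have "card (stubs d (V - C)) = sum d (V - C)"
    by (rule card_stubs) (use V in simp)
  also have "\<dots> = sum d V - sum d C"
    by (rule sum_diff_nat) (use C V finite_subset in blast)+
  also have "sum d C = D * card C"
    using C(2) by simp
  finally show ?thesis
    using V by (simp add: card_perfect_matchings finite_stubs flip: stubs_Diff)
qed

lemma card_closed_regular:
  assumes V: "finite V" and C: "C \<subseteq> V" "\<And>i. i \<in> C \<Longrightarrow> d i = D"
  shows "card {M \<in> perfect_matchings (stubs d V). matching_closed M (stubs d C)} =
    split_weight (sum d V) (D * card C)"
proof -
  have "finite C" using C V finite_subset by blast
  then have "card (perfect_matchings (stubs d C)) = num_matchings (D * card C)"
    using C by (simp add: card_perfect_matchings finite_stubs card_regular_stubs)
  with card_matchings_outside[OF V C] show ?thesis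
    by (simp add: card_matchings_closed[OF stubs_mono[OF C(1)]] split_weight_def)
qed

text \<open>
  Whether a closed set is connected depends only on the pairs inside it.
\<close>

lemma card_connected_regular:
  assumes V: "finite V" and C: "C \<subseteq> V" "\<And>i. i \<in> C \<Longrightarrow> d i = D"
  shows "card {M \<in> perfect_matchings (stubs d V).
      matching_closed M (stubs d C) \<and> matching_connected d C M} =
    card {M \<in> perfect_matchings (stubs d C). matching_connected d C M} *
      num_matchings (sum d V - D * card C)"
proof -
  have "matching_connected d C (M \<inter> Pow (stubs d C)) \<longleftrightarrow> matching_connected d C M"
    if "matching_closed M (stubs d C)" for M
    using matching_closed_restrict[OF that] stubs_mono
    unfolding matching_connected_def by (metis psubset_imp_subset)
  then have "{M \<in> perfect_matchings (stubs d V).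
      matching_closed M (stubs d C) \<and> matching_connected d C M} =
     {M \<in> perfect_matchings (stubs d V).
      matching_closed M (stubs d C) \<and> matching_connected d C (M \<inter> Pow (stubs d C))}"
    by blast
  with card_matchings_outside[OF V C] show ?thesis
    by (simp add: card_matchings_split[OF stubs_mono[OF C(1)], where P = "matching_connected d C"])
qed

lemma sum_proper_subsets_by_card:
  fixes g :: "nat \<Rightarrow> nat"
  assumes "finite C"
  shows "(\<Sum>S | S \<noteq> {} \<and> S \<subset> C. g (card S)) = (\<Sum>k\<in>{1..<card C}. (card C choose k) * g k)"
proof -
  let ?A = "{S. S \<noteq> {} \<and> S \<subset> C}"
  have fin: "finite ?A" by (rule finite_subset[of _ "Pow C"]) (use assms in auto)
  have "card ` ?A \<subseteq> {1..<card C}"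
  proof
    fix k
    assume "k \<in> card ` ?A"
    then obtain S where S: "k = card S" "S \<noteq> {}" "S \<subset> C" by blast
    then have "finite S" using assms finite_subset by blast
    with S assms show "k \<in> {1..<card C}"
      by (simp add: psubset_card_mono Suc_le_eq card_gt_0_iff)
  qed
  then have "(\<Sum>S\<in>?A. g (card S)) = (\<Sum>k\<in>{1..<card C}. \<Sum>S | S \<in> ?A \<and> card S = k. g (card S))"
    using fin by (intro sum.group[symmetric]) auto
  also have "\<dots> = (\<Sum>k\<in>{1..<card C}. (card C choose k) * g k)"
  proof (rule sum.cong)
    fix k
    assume k: "k \<in> {1..<card C}"
    then have "{S. S \<in> ?A \<and> card S = k} = {S. S \<subseteq> C \<and> card S = k}"
      by auto
    with assms show "(\<Sum>S | S \<in> ?A \<and> card S = k. g (card S)) = (card C choose k) * g k"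
      by (simp add: n_subsets)
  qed simp
  finally show ?thesis .
qed

text \<open>
  The union bound over all proper subsets that could be closed.
\<close>

lemma card_disconnected_le:
  assumes C: "finite C" "\<And>i. i \<in> C \<Longrightarrow> d i = D"
  shows "card {M \<in> perfect_matchings (stubs d C). \<not> matching_connected d C M} \<le>
    (\<Sum>k\<in>{1..<card C}. (card C choose k) * split_weight (D * card C) (D * k))"
proof -
  let ?A = "{S. S \<noteq> {} \<and> S \<subset> C}"
  have fin: "finite ?A" by (rule finite_subset[of _ "Pow C"]) (use assms in auto)
  have "{M \<in> perfect_matchings (stubs d C). \<not> matching_connected d C M} =
      (\<Union>S\<in>?A. {M \<in> perfect_matchings (stubs d C). matching_closed M (stubs d S)})"
    by (auto simp: matching_connected_def)
  then have "card {M \<in> perfect_matchings (stubs d C). \<not> matching_connected d C M} \<le>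
      (\<Sum>S\<in>?A. card {M \<in> perfect_matchings (stubs d C). matching_closed M (stubs d S)})"
    using card_UN_le[OF fin] by simp
  also have "\<dots> = (\<Sum>S\<in>?A. split_weight (D * card C) (D * card S))"
    using C by (intro sum.cong refl, subst card_closed_regular[of _ _ _ D]) (auto simp: mult.commute)
  also have "\<dots> = (\<Sum>k\<in>{1..<card C}. (card C choose k) * split_weight (D * card C) (D * k))"
    by (rule sum_proper_subsets_by_card[OF C(1)])
  finally show ?thesis .
qed

section \<open>Connectivity of large random regular multigraphs\<close>

text \<open>
  A single term of Vandermonde's identity.
\<close>

lemma binomial_mult_le: "(a choose b) * (c choose e) \<le> (a + c) choose (b + e)"
proof -
  have "(a choose b) * (c choose e) = (a choose b) * (c choose (b + e - b))" by simp
  also have "\<dots> \<le> (\<Sum>k\<le>b + e. (a choose k) * (c choose (b + e - k)))"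
    by (rule member_le_sum[of b _ "\<lambda>k. (a choose k) * (c choose (b + e - k))"]) auto
  also have "\<dots> = (a + c) choose (b + e)" by (rule vandermonde)
  finally show ?thesis .
qed

lemma binomial_power_le: "(n choose k) ^ m \<le> (m * n) choose (m * k)"
proof (induction m)
  case (Suc m)
  have "(n choose k) ^ Suc m \<le> (n choose k) * ((m * n) choose (m * k))"
    using Suc.IH by simp
  also have "\<dots> \<le> (Suc m * n) choose (Suc m * k)"
    using binomial_mult_le[of n k "m * n" "m * k"] by simp
  finally show ?case .
qed simp

lemma split_weight_eq_binomial:
  assumes "even T" "even k" "k \<le> T"
  shows "real (split_weight T k) / real (num_matchings T) =
    real (T div 2 choose (k div 2)) / real (T choose k)"
proof -
  obtain a where a: "k = 2 * a" using assms by (auto elim: evenE)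
  obtain b where b: "T = 2 * b" using assms by (auto elim: evenE)
  define c where "c = b - a"
  have "b = a + c" using a b assms by (simp add: c_def)
  then have T: "T = 2 * (a + c)" "T - k = 2 * c" using a b by auto
  show ?thesis
    using num_matchings_ratio[of a c] unfolding split_weight_def T(2)
    by (simp add: T(1) a del: distrib_left_numeral)
qed

lemma split_weight_odd: "odd k \<Longrightarrow> split_weight T k = 0"
  by (simp add: split_weight_def num_matchings_def)

text \<open>
  Put \<open>b = (N choose k)\<close> and \<open>B = (D N choose D k)\<close>. The probability that \<open>k\<close> given vertices
  form a closed set is \<open>(D N / 2 choose D k / 2) / B\<close>, whose numerator is at most \<open>sqrt B\<close>.
  Since \<open>B \<ge> b ^ D \<ge> b ^ 3\<close>, the expected number \<open>b / sqrt B\<close> is at most \<open>1 / sqrt b\<close>. For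
  degree two this argument would only give the bound one.
\<close>

lemma weighted_choices_le:
  assumes D: "D \<ge> 3" and N: "even (D * N)" "k \<le> N"
  shows "real (N choose k) * (real (split_weight (D * N) (D * k)) / real (num_matchings (D * N)))
    \<le> 1 / sqrt (real (N choose k))"
proof (cases "even (D * k)")
  case False
  then show ?thesis by (simp add: split_weight_odd)
next
  case True
  define b where "b = real (N choose k)"
  define B where "B = real ((D * N) choose (D * k))"
  define h where "h = real ((D * N) div 2 choose ((D * k) div 2))"
  have b: "b \<ge> 1" using N by (simp add: b_def Suc_le_eq)
  have B: "B > 0" using N by (simp add: B_def)
  have "real (((D * N) div 2 choose ((D * k) div 2)) ^ 2) \<le> B"
    unfolding B_def of_nat_le_iff
    using binomial_power_le[of "(D * N) div 2" "(D * k) div 2" 2] N True by simp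
  then have h: "h \<le> sqrt B" by (simp add: h_def real_le_rsqrt)
  have "b ^ 3 \<le> b ^ D" using b D by (rule power_increasing[rotated])
  also have "b ^ D \<le> B"
    unfolding b_def B_def of_nat_power[symmetric] of_nat_le_iff by (rule binomial_power_le)
  finally have "sqrt (b ^ 3) \<le> sqrt B" by simp
  then have bB: "b * sqrt b \<le> sqrt B" using b by (simp add: power3_eq_cube real_sqrt_mult)
  have "b * (h / B) \<le> b * (sqrt B / B)"
    using h b B by (intro mult_left_mono divide_right_mono) auto
  also have "\<dots> = b / sqrt B" using B by (simp add: real_div_sqrt divide_simps)
  also have "\<dots> \<le> b / (b * sqrt b)"
    using bB b B by (intro divide_left_mono) auto
  also have "\<dots> = 1 / sqrt b" using b by simp
  finally show ?thesis
    using split_weight_eq_binomial[OF N(1) True] N by (simp add: b_def B_def h_def)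
qed

lemma binomial_ge_edge:
  assumes "j \<le> k" "j + k \<le> n"
  shows "n choose j \<le> n choose k"
proof (cases "2 * k \<le> n")
  case True
  with assms show ?thesis by (intro binomial_mono) auto
next
  case False
  have "n choose j \<le> n choose (n - k)" using False assms by (intro binomial_mono) auto
  then show ?thesis using assms by (simp add: binomial_symmetric[of k n])
qed

text \<open>
  The two outermost terms at either end are at most \<open>1 / sqrt n\<close>. All others are at most
  \<open>1 / sqrt (n choose 3)\<close>, which is of order \<open>n powr (- 3 / 2)\<close>, so that even \<open>n\<close> of them are
  negligible.
\<close>

lemma sum_inverse_sqrt_binomial_tendsto_0:
  "(\<lambda>n. \<Sum>k\<in>{1..<n}. 1 / sqrt (real (n choose k))) \<longlonglongrightarrow> 0"
proof -
  let ?b = "\<lambda>n. 4 * (1 / sqrt (real n)) + real n * (1 / sqrt (real n * (real n - 1) * (real n - 2) / 6))"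
  have upper: "\<forall>\<^sub>F n in sequentially. (\<Sum>k\<in>{1..<n}. 1 / sqrt (real (n choose k))) \<le> ?b n"
    using eventually_ge_at_top[of 6]
  proof eventually_elim
    case (elim n)
    let ?f = "\<lambda>k. 1 / sqrt (real (n choose k))"
    have c3: "real (n choose 3) = real n * (real n - 1) * (real n - 2) / 6"
      using elim by (simp add: binomial_gbinomial gbinomial_prod_rev numeral_eq_Suc
          prod.atLeast0_lessThan_Suc fact_reduce field_simps)
    have "(\<Sum>k\<in>{1..<n}. ?f k) = (\<Sum>k\<in>{1, 2, n - 2, n - 1} \<union> {3..n - 3}. ?f k)"
      using elim by (intro sum.cong) auto
    also have "\<dots> \<le> (\<Sum>k\<in>{1, 2, n - 2, n - 1}. ?f k) + (\<Sum>k\<in>{3..n - 3}. ?f k)"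
      by (subst sum_Un) (auto intro!: sum_nonneg)
    also have "(\<Sum>k\<in>{1, 2, n - 2, n - 1}. ?f k) \<le> (\<Sum>k\<in>{1, 2, n - 2, n - 1}. 1 / sqrt (real n))"
    proof (intro sum_mono divide_left_mono)
      fix k
      assume "k \<in> {1, 2, n - 2, n - 1}"
      then have "n choose 1 \<le> n choose k" using elim by (intro binomial_ge_edge) auto
      then show "sqrt (real n) \<le> sqrt (real (n choose k))" by simp
      moreover have "real n > 0" using elim by simp
      ultimately show "0 < sqrt (real (n choose k)) * sqrt (real n)"
        by (metis less_le_trans mult_pos_pos real_sqrt_gt_zero)
    qed simp
    also have "(\<Sum>k\<in>{1, 2, n - 2, n - 1}. 1 / sqrt (real n)) = 4 * (1 / sqrt (real n))"
    proof -
      have "1 \<noteq> n - 2" "1 \<noteq> n - 1" "2 \<noteq> n - 2" "2 \<noteq> n - 1" "n - 2 \<noteq> n - 1"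
        using elim by arith+
      then have "card {1, 2, n - 2, n - 1} = 4" by simp
      then show ?thesis by (simp only: sum_constant)
    qed
    also have "(\<Sum>k\<in>{3..n - 3}. ?f k) \<le> real (card {3..n - 3}) * (1 / sqrt (real (n choose 3)))"
    proof (intro sum_bounded_above divide_left_mono)
      fix k
      assume "k \<in> {3..n - 3}"
      then have *: "n choose 3 \<le> n choose k" using elim by (intro binomial_ge_edge) auto
      then show "sqrt (real (n choose 3)) \<le> sqrt (real (n choose k))" by simp
      have "n choose 3 > 0" using elim by simp
      with * have "real (n choose k) > 0" "real (n choose 3) > 0" by linarith+
      then show "0 < sqrt (real (n choose k)) * sqrt (real (n choose 3))"
        by (intro mult_pos_pos real_sqrt_gt_zero)
    qed simp
    also have "\<dots> \<le> real n * (1 / sqrt (real (n choose 3)))"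
      by (intro mult_right_mono) auto
    finally show ?case by (simp add: c3)
  qed
  have "?b \<longlonglongrightarrow> 0" by real_asymp
  with upper show ?thesis
    by (rule tendsto_sandwich[OF always_eventually _ tendsto_const, rotated])
      (auto intro!: sum_nonneg)
qed

text \<open>
  The union bound over all proper nonempty subsets. For an odd number \<open>D N\<close> of half-edges there
  are no matchings and both sides vanish.
\<close>

lemma eventually_half_connected:
  fixes D :: nat
  assumes D: "D \<ge> 3"
  shows "\<forall>\<^sub>F N in sequentially. \<forall>C (d :: 'v \<Rightarrow> nat). finite C \<longrightarrow> card C = N \<longrightarrow> (\<forall>i\<in>C. d i = D) \<longrightarrow>
    num_matchings (D * N) \<le> 2 * card {M \<in> perfect_matchings (stubs d C). matching_connected d C M}"
proof -
  \<comment> \<open>The expected number of proper nonempty closed subsets bounds the probability of disconnectedness.\<close>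
  have "\<forall>\<^sub>F N in sequentially. (\<Sum>k\<in>{1..<N}. 1 / sqrt (real (N choose k))) < 1 / 2"
    using sum_inverse_sqrt_binomial_tendsto_0 by (rule order_tendstoD) simp
  then show ?thesis
  proof eventually_elim
    case (elim N)
    show ?case
    proof (intro allI impI)
      fix C and d :: "'v \<Rightarrow> nat"
      assume C: "finite C" "card C = N" "\<forall>i\<in>C. d i = D"
      show "num_matchings (D * N) \<le>
          2 * card {M \<in> perfect_matchings (stubs d C). matching_connected d C M}"
      proof (cases "even (D * N)")
        case False
        then show ?thesis by (simp add: num_matchings_def)
      next
        case True
        let ?m = "real (num_matchings (D * N))"
        let ?P = "perfect_matchings (stubs d C)"
        let ?c = "card {M \<in> ?P. matching_connected d C M}"
        let ?u = "card {M \<in> ?P. \<not> matching_connected d C M}"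
        have m: "?m > 0" using num_matchings_pos[OF True] by simp
        have fin: "finite ?P" using C by (simp add: finite_perfect_matchings finite_stubs)
        have "num_matchings (D * N) = card ?P"
          using C by (simp add: card_perfect_matchings finite_stubs card_regular_stubs)
        also have "?P = {M \<in> ?P. matching_connected d C M} \<union> {M \<in> ?P. \<not> matching_connected d C M}"
          by blast
        also have "card \<dots> = ?c + ?u"
          by (rule card_Un_disjoint) (use fin in auto)
        finally have split: "num_matchings (D * N) = ?c + ?u" .
        have "real ?u \<le> real (\<Sum>k\<in>{1..<N}. (N choose k) * split_weight (D * N) (D * k))"
          using card_disconnected_le[of C d D] C unfolding of_nat_le_iff by simp
        also have "\<dots> = ?m * (\<Sum>k\<in>{1..<N}. real (N choose k) *
            (real (split_weight (D * N) (D * k)) / ?m))"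
          using m by (simp add: sum_distrib_left)
        also have "\<dots> \<le> ?m * (\<Sum>k\<in>{1..<N}. 1 / sqrt (real (N choose k)))"
          using m D True by (intro mult_left_mono sum_mono weighted_choices_le) auto
        also have "\<dots> \<le> ?m * (1 / 2)"
          using m elim by (intro mult_left_mono) auto
        finally have "2 * real ?u \<le> ?m" by simp
        with split show ?thesis by linarith
      qed
    qed
  qed
qed

section \<open>Bounds for the probability of a regular component\<close>

text \<open>
  The expected number of closed sets of \<open>N\<close> vertices, all of degree \<open>D\<close>, when \<open>s\<close> vertices have
  degree \<open>D\<close> and there are \<open>T\<close> half-edges.
\<close>

definition expected_closed :: "nat \<Rightarrow> nat \<Rightarrow> nat \<Rightarrow> nat \<Rightarrow> real" where
  "expected_closed s T D N = real (s choose N) * (real (split_weight T (D * N)) / real (num_matchings T))"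

context
  fixes n :: nat and d :: "nat \<Rightarrow> nat"
  assumes even_sum: "even (\<Sum>i=1..n. d i)"
begin

lemma half_edge_matchings:
  "finite (perfect_matchings (half_edges n d))"
  "card (perfect_matchings (half_edges n d)) = num_matchings (\<Sum>i=1..n. d i)"
  "perfect_matchings (half_edges n d) \<noteq> {}"
proof -
  show "finite (perfect_matchings (half_edges n d))"
    by (simp add: half_edges_eq_stubs finite_perfect_matchings finite_stubs)
  show c: "card (perfect_matchings (half_edges n d)) = num_matchings (\<Sum>i=1..n. d i)"
    by (simp add: half_edges_eq_stubs card_perfect_matchings finite_stubs card_stubs)
  show "perfect_matchings (half_edges n d) \<noteq> {}"
    using num_matchings_pos[OF even_sum] c by (metis card.empty less_numeral_extra(3))
qed

lemma prob_configuration_model: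
  "measure_pmf.prob (configuration_model n d) E =
    real (card {M \<in> perfect_matchings (half_edges n d). graph_of_matching M \<in> E}) /
      real (num_matchings (\<Sum>i=1..n. d i))"
proof -
  have "perfect_matchings (half_edges n d) \<inter> graph_of_matching -` E =
      {M \<in> perfect_matchings (half_edges n d). graph_of_matching M \<in> E}"
    by auto
  then show ?thesis
    unfolding configuration_model_def measure_map_pmf
    by (simp add: measure_pmf_of_set half_edge_matchings)
qed

lemma n_subsets_degree:
  "card {C. C \<subseteq> {i \<in> {1..n}. d i = D} \<and> card C = N} = degree_count n d D choose N"
  by (simp add: n_subsets degree_count_def)

text \<open>
  A component is closed, and its vertices have degree \<open>D\<close> in the multigraph only if they carry \<open>D\<close>
  half-edges.
\<close>

lemma regular_component_prob_le:
  "measure_pmf.prob (configuration_model n d) (regular_component_event n D q \<epsilon>) \<le>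
    (\<Sum>N | N \<le> degree_count n d D \<and> real N \<in> {real n * (q - \<epsilon>)..real n * (q + \<epsilon>)}.
      expected_closed (degree_count n d D) (\<Sum>i=1..n. d i) D N)"
proof -
  let ?P = "perfect_matchings (half_edges n d)"
  let ?T = "\<Sum>i=1..n. d i"
  let ?s = "degree_count n d D"
  let ?V = "{i \<in> {1..n}. d i = D}"
  let ?W = "{N. N \<le> ?s \<and> real N \<in> {real n * (q - \<epsilon>)..real n * (q + \<epsilon>)}}"
  let ?E = "{M \<in> ?P. graph_of_matching M \<in> regular_component_event n D q \<epsilon>}"
  let ?A = "\<lambda>C. {M \<in> ?P. matching_closed M (stubs d C)}"
  let ?S = "\<lambda>N. {C. C \<subseteq> ?V \<and> card C = N}"
  have finW: "finite ?W" by (rule finite_subset[of _ "{..?s}"]) auto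
  have finS: "finite (?S N)" for N by (rule finite_subset[of _ "Pow ?V"]) auto
  have "?E \<subseteq> (\<Union>N\<in>?W. \<Union>C\<in>?S N. ?A C)"
  proof
    fix M
    assume "M \<in> ?E"
    then obtain C where M: "M \<in> perfect_matchings (stubs d {1..n})"
      and C: "C \<in> connected_components {1..n} (graph_of_matching M)"
        "\<forall>v\<in>C. mdegree (graph_of_matching M) v = D"
        "real (card C) \<in> {real n * (q - \<epsilon>)..real n * (q + \<epsilon>)}"
      by (auto simp: regular_component_event_def half_edges_eq_stubs)
    have sub: "C \<subseteq> {1..n}" using C(1) by (auto simp: connected_components_def quotient_def)
    with C(2) have V: "C \<subseteq> ?V"
      using mdegree_graph_of_matching[OF finite_atLeastAtMost M] by (auto simp: subset_iff)
    then have "card C \<le> ?s" unfolding degree_count_def by (intro card_mono) auto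
    with C(3) have "card C \<in> ?W" by simp
    moreover have "M \<in> ?A C"
      using component_closed[OF finite_atLeastAtMost M C(1)] M by (simp add: half_edges_eq_stubs)
    ultimately show "M \<in> (\<Union>N\<in>?W. \<Union>C\<in>?S N. ?A C)" using V by blast
  qed
  then have "card ?E \<le> card (\<Union>N\<in>?W. \<Union>C\<in>?S N. ?A C)"
    using finW finS half_edge_matchings by (intro card_mono) auto
  also have "\<dots> \<le> (\<Sum>N\<in>?W. card (\<Union>C\<in>?S N. ?A C))"
    using finW by (rule card_UN_le)
  also have "\<dots> \<le> (\<Sum>N\<in>?W. \<Sum>C\<in>?S N. card (?A C))"
    using finS by (intro sum_mono card_UN_le)
  also have "\<dots> = (\<Sum>N\<in>?W. \<Sum>C\<in>?S N. split_weight ?T (D * N))"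
  proof (intro sum.cong refl)
    fix N C
    assume "C \<in> ?S N"
    then have C: "C \<subseteq> {1..n}" "\<And>i. i \<in> C \<Longrightarrow> d i = D" "card C = N" by blast+
    show "card (?A C) = split_weight ?T (D * N)"
      using card_closed_regular[OF finite_atLeastAtMost C(1,2)] C(3)
      by (simp add: half_edges_eq_stubs)
  qed
  also have "\<dots> = (\<Sum>N\<in>?W. (?s choose N) * split_weight ?T (D * N))"
    by (simp only: sum_constant n_subsets_degree of_nat_id)
  finally have "card ?E \<le> (\<Sum>N\<in>?W. (?s choose N) * split_weight ?T (D * N))" .
  then have "real (card ?E) \<le> real (\<Sum>N\<in>?W. (?s choose N) * split_weight ?T (D * N))"
    by (rule of_nat_mono)
  then have "real (card ?E) \<le> (\<Sum>N\<in>?W. real (?s choose N) * real (split_weight ?T (D * N)))"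
    by (simp only: of_nat_sum of_nat_mult of_nat_id)
  then have "real (card ?E) / real (num_matchings ?T) \<le>
      (\<Sum>N\<in>?W. real (?s choose N) * real (split_weight ?T (D * N))) / real (num_matchings ?T)"
    by (rule divide_right_mono) simp
  then show ?thesis
    unfolding prob_configuration_model by (simp add: expected_closed_def sum_divide_distrib)
qed

text \<open>
  Count pairs of a matching and a connected closed set of size \<open>N\<close> in two ways. For a given set,
  at least half of the matchings for which it is closed make it connected. For a given matching,
  such sets are components, so there are at most \<open>n\<close> of them, and none unless the event occurs.
\<close>

lemma regular_component_prob_ge:
  assumes half: "\<And>C. C \<subseteq> {1..n} \<Longrightarrow> card C = N \<Longrightarrow> (\<forall>i\<in>C. d i = D) \<Longrightarrow>
      num_matchings (D * N) \<le> 2 * card {M \<in> perfect_matchings (stubs d C). matching_connected d C M}"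
    and N: "N \<ge> 1" "real N \<in> {real n * (q - \<epsilon>)..real n * (q + \<epsilon>)}"
  shows "expected_closed (degree_count n d D) (\<Sum>i=1..n. d i) D N \<le> 2 * real n *
    measure_pmf.prob (configuration_model n d) (regular_component_event n D q \<epsilon>)"
proof -
  let ?P = "perfect_matchings (half_edges n d)"
  let ?T = "\<Sum>i=1..n. d i"
  let ?s = "degree_count n d D"
  let ?V = "{i \<in> {1..n}. d i = D}"
  let ?E = "{M \<in> ?P. graph_of_matching M \<in> regular_component_event n D q \<epsilon>}"
  let ?S = "{C. C \<subseteq> ?V \<and> card C = N}"
  let ?R = "\<lambda>M C. matching_closed M (stubs d C) \<and> matching_connected d C M"
  have finS: "finite ?S" by (rule finite_subset[of _ "Pow ?V"]) auto
  have comp: "C \<in> connected_components {1..n} (graph_of_matching M)"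
    if "M \<in> ?P" "C \<in> ?S" "?R M C" for M C
    using that N(1)
    by (intro minimal_closed_component[of _ M d]) (auto simp: half_edges_eq_stubs matching_connected_def)
  have count: "card {C \<in> ?S. ?R M C} \<le> (if M \<in> ?E then n else 0)" if M: "M \<in> ?P" for M
  proof (cases "M \<in> ?E")
    case True
    have "{C \<in> ?S. ?R M C} \<subseteq> connected_components {1..n} (graph_of_matching M)"
      using comp[OF M] by blast
    then have "card {C \<in> ?S. ?R M C} \<le> card (connected_components {1..n} (graph_of_matching M))"
      by (intro card_mono finite_connected_components finite_atLeastAtMost)
    also have "\<dots> \<le> card {1..n}" by (rule card_connected_components_le) simp
    finally show ?thesis using True by simp
  next
    case False
    have M': "M \<in> perfect_matchings (stubs d {1..n})" using M by (simp add: half_edges_eq_stubs)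
    have "M \<in> ?E" if C: "C \<in> ?S" "?R M C" for C
    proof -
      have "mdegree (graph_of_matching M) v = D" if "v \<in> C" for v
      proof -
        have "v \<in> {1..n}" "d v = D" using that C(1) by blast+
        then show ?thesis using mdegree_graph_of_matching[OF finite_atLeastAtMost M'] by simp
      qed
      moreover have "card C = N" using C(1) by blast
      ultimately show ?thesis
        using comp[OF M C] M N(2) unfolding regular_component_event_def by auto
    qed
    with False have "{C \<in> ?S. ?R M C} = {}" by blast
    then have "card {C \<in> ?S. ?R M C} = 0" by (simp only: card.empty)
    then show ?thesis by (rule eq_refl[THEN le_trans]) (rule le0)
  qed
  have "(?s choose N) * split_weight ?T (D * N) = (\<Sum>C\<in>?S. split_weight ?T (D * N))"
    by (simp only: sum_constant n_subsets_degree of_nat_id)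
  also have "\<dots> \<le> (\<Sum>C\<in>?S. 2 * card {M \<in> ?P. ?R M C})"
  proof (rule sum_mono)
    fix C
    assume "C \<in> ?S"
    then have C: "C \<subseteq> {1..n}" "\<And>i. i \<in> C \<Longrightarrow> d i = D" "card C = N" by blast+
    let ?c = "card {M \<in> perfect_matchings (stubs d C). matching_connected d C M}"
    have "split_weight ?T (D * N) \<le> (2 * ?c) * num_matchings (?T - D * N)"
      unfolding split_weight_def using half[OF C(1,3)] C(2) by (intro mult_right_mono) auto
    also have "\<dots> = 2 * card {M \<in> ?P. ?R M C}"
      using card_connected_regular[OF finite_atLeastAtMost C(1,2)] C(3)
      by (simp add: half_edges_eq_stubs)
    finally show "split_weight ?T (D * N) \<le> 2 * card {M \<in> ?P. ?R M C}" .
  qed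
  also have "\<dots> = 2 * (\<Sum>C\<in>?S. card {M \<in> ?P. ?R M C})"
    by (simp add: sum_distrib_left)
  also have "(\<Sum>C\<in>?S. card {M \<in> ?P. ?R M C}) = (\<Sum>M\<in>?P. card {C \<in> ?S. ?R M C})"
    by (rule sum_multicount_gen[where R = "\<lambda>C M. ?R M C", OF finS half_edge_matchings(1)]) simp
  also have "\<dots> \<le> (\<Sum>M\<in>?P. if M \<in> ?E then n else 0)"
    using count by (rule sum_mono)
  also have "\<dots> = (\<Sum>M\<in>?P \<inter> ?E. n)"
    by (rule sum.inter_restrict[OF half_edge_matchings(1), symmetric])
  also have "?P \<inter> ?E = ?E" by blast
  also have "(\<Sum>M\<in>?E. n) = card ?E * n" by (simp only: sum_constant of_nat_id)
  finally have "(?s choose N) * split_weight ?T (D * N) \<le> 2 * (card ?E * n)"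
    by (simp only: mult_le_mono2)
  then have "real ((?s choose N) * split_weight ?T (D * N)) \<le> real (2 * (card ?E * n))"
    by (rule of_nat_mono)
  then have "real (?s choose N) * real (split_weight ?T (D * N)) \<le> 2 * (real n * real (card ?E))"
    by (simp only: of_nat_mult of_nat_numeral mult.commute[of "real n"])
  then have "real (?s choose N) * real (split_weight ?T (D * N)) / real (num_matchings ?T) \<le>
      2 * (real n * real (card ?E)) / real (num_matchings ?T)"
    by (rule divide_right_mono) simp
  then show ?thesis
    unfolding prob_configuration_model expected_closed_def by simp
qed

end

section \<open>Exponential rates of binomial coefficients\<close>

text \<open>
  The function \<open>x ln x\<close> on the nonnegative reals. The even extension makes it continuous on the
  whole line, so that no boundary cases arise at \<open>0\<close>.
\<close>

definition phi :: "real \<Rightarrow> real" where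
  "phi x = \<bar>x\<bar> * ln \<bar>x\<bar>"

lemma phi_nonneg: "x \<ge> 0 \<Longrightarrow> phi x = x * ln x"
  by (simp add: phi_def)

lemma isCont_phi: "isCont phi x"
proof (cases "x = 0")
  case True
  have "((\<lambda>x::real. \<bar>x\<bar> * ln \<bar>x\<bar>) \<longlongrightarrow> 0) (at 0)"
  proof (rule filterlim_split_at_real)
    show "((\<lambda>x::real. \<bar>x\<bar> * ln \<bar>x\<bar>) \<longlongrightarrow> 0) (at_left 0)" by real_asymp
    show "((\<lambda>x::real. \<bar>x\<bar> * ln \<bar>x\<bar>) \<longlongrightarrow> 0) (at_right 0)" by real_asymp
  qed
  then show ?thesis by (simp add: isCont_def True phi_def[abs_def])
next
  case False
  then show ?thesis unfolding phi_def[abs_def] by (intro continuous_intros) auto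
qed

lemma phi_scale:
  assumes "c > 0" "x \<ge> 0"
  shows "phi (c * x) = c * phi x + c * x * ln c"
  using assms by (cases "x = 0") (simp_all add: phi_nonneg ln_mult algebra_simps)

text \<open>
  Both bounds on the factorial come from comparing \<open>ln ((n + 1) / n)\<close> with \<open>1 / n\<close> and with
  \<open>1 / (n + 1)\<close> in the induction step. They miss Stirling's formula by a logarithmic term, which is
  irrelevant on the exponential scale.
\<close>

lemma ln_fact_lower: "real n * ln (real n) - real n \<le> ln (fact n)"
proof (induction n)
  case (Suc n)
  show ?case
  proof (cases "n = 0")
    case False
    have "ln (real (Suc n) / real n) \<le> real (Suc n) / real n - 1"
      using False by (intro ln_le_minus_one) auto
    also have "\<dots> = 1 / real n" using False by (simp add: field_simps)
    finally have "real n * (ln (real (Suc n)) - ln (real n)) \<le> real n * (1 / real n)"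
      using False by (intro mult_left_mono) (auto simp: ln_div)
    then have "real n * ln (real (Suc n)) \<le> real n * ln (real n) + 1"
      using False by (simp add: algebra_simps)
    moreover have "ln (fact (Suc n) :: real) = ln (real (Suc n)) + ln (fact n)"
      unfolding fact_Suc by (subst ln_mult) auto
    moreover have "real (Suc n) * ln (real (Suc n)) = real n * ln (real (Suc n)) + ln (real (Suc n))"
      by (simp add: algebra_simps)
    ultimately show ?thesis using Suc.IH by simp
  qed simp
qed simp

lemma ln_fact_upper: "n \<ge> 1 \<Longrightarrow> ln (fact n) \<le> real n * ln (real n) - real n + 1 + ln (real n)"
proof (induction n rule: dec_induct)
  case (step n)
  have "ln (real n / real (Suc n)) \<le> real n / real (Suc n) - 1"
    using step by (intro ln_le_minus_one) auto
  also have "\<dots> = - (1 / real (Suc n))" by (simp add: field_simps)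
  finally have "real (Suc n) * (1 / real (Suc n)) \<le> real (Suc n) * (ln (real (Suc n)) - ln (real n))"
    using step by (intro mult_left_mono) (auto simp: ln_div)
  then have "1 \<le> real (Suc n) * ln (real (Suc n)) - real (Suc n) * ln (real n)"
    by (simp add: right_diff_distrib)
  moreover have "real (Suc n) * ln (real n) = real n * ln (real n) + ln (real n)"
    by (simp add: algebra_simps)
  moreover have "ln (fact (Suc n) :: real) = ln (real (Suc n)) + ln (fact n)"
    unfolding fact_Suc by (subst ln_mult) auto
  ultimately show ?case using step.IH by simp
qed simp

lemma ln_fact_approx: "\<bar>ln (fact n) - (phi (real n) - real n)\<bar> \<le> ln (real n + 1) + 1"
proof (cases "n = 0")
  case False
  then have "ln (real n) \<le> ln (real n + 1)" "0 \<le> ln (real n + 1)" "n \<ge> 1" by auto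
  moreover have "phi (real n) = real n * ln (real n)" by (simp add: phi_nonneg)
  ultimately show ?thesis
    using ln_fact_lower[of n] ln_fact_upper[of n] by linarith
qed (simp add: phi_def)

text \<open>
  Up to logarithmic terms this is \<open>ln (a choose x)\<close>: the linear terms of Stirling's formula
  cancel.
\<close>

definition choose_rate :: "real \<Rightarrow> real \<Rightarrow> real" where
  "choose_rate a x = phi a - phi x - phi (a - x)"

text \<open>
  The terms \<open>c ln c\<close> that arise from scaling \<open>phi\<close> cancel because \<open>a = x + (a - x)\<close>.
\<close>

lemma choose_rate_scale:
  assumes "c > 0" "0 \<le> x" "x \<le> a"
  shows "choose_rate (c * a) (c * x) = c * choose_rate a x"
proof -
  have "c * a - c * x = c * (a - x)" by (simp add: algebra_simps)
  with assms show ?thesis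
    unfolding choose_rate_def by (simp only: phi_scale) (simp add: phi_scale algebra_simps)
qed

lemma ln_binomial_approx:
  assumes "k \<le> m"
  shows "\<bar>ln (real (m choose k)) - choose_rate (real m) (real k)\<bar> \<le> 3 * (ln (real m + 1) + 1)"
proof -
  have "real (m choose k) = fact m / (fact k * fact (m - k))"
    by (rule binomial_fact[OF assms])
  then have "ln (real (m choose k)) = ln (fact m) - ln (fact k) - ln (fact (m - k))"
    by (simp add: ln_div ln_mult)
  moreover have "ln (real k + 1) \<le> ln (real m + 1)" "ln (real (m - k) + 1) \<le> ln (real m + 1)"
    using assms by auto
  ultimately show ?thesis
    using ln_fact_approx[of m, THEN abs_le_D1] ln_fact_approx[of m, THEN abs_le_D2]
      ln_fact_approx[of k, THEN abs_le_D1] ln_fact_approx[of k, THEN abs_le_D2]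
      ln_fact_approx[of "m - k", THEN abs_le_D1] ln_fact_approx[of "m - k", THEN abs_le_D2]
    unfolding choose_rate_def of_nat_diff[OF assms] by argo
qed

text \<open>
  The exponential rate of the expected number of closed sets, for \<open>a n\<close> vertices of degree \<open>D\<close>,
  \<open>b n\<close> half-edges and a set of \<open>x n\<close> vertices. The second term combines the rates of
  \<open>(t choose k)\<close> and \<open>1 / (2 t choose 2 k)\<close> for \<open>t = b n / 2\<close> and \<open>k = D x n / 2\<close>.
\<close>

definition component_rate :: "nat \<Rightarrow> real \<Rightarrow> real \<Rightarrow> real \<Rightarrow> real" where
  "component_rate D a b x = choose_rate a x - choose_rate (b / 2) (real D * x / 2)"

lemma expected_closed_odd: "odd (D * N) \<Longrightarrow> expected_closed s T D N = 0"
  by (simp add: expected_closed_def split_weight_odd)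

lemma expected_closed_approx:
  assumes n: "n > 0" and T: "even T" and N: "even (D * N)" "N \<le> s" "D * s \<le> T" and D: "D \<ge> 1"
  shows "expected_closed s T D N > 0"
    and "\<bar>ln (expected_closed s T D N) / real n -
      component_rate D (real s / real n) (real T / real n) (real N / real n)\<bar>
      \<le> 9 * (ln (real T + 1) + 1) / real n"
proof -
  define t where "t = T div 2"
  define k where "k = D * N div 2"
  have Tt: "T = 2 * t" using T by (simp add: t_def)
  have Nk: "D * N = 2 * k" using N by (simp add: k_def)
  have "D * N \<le> T" using N by (meson le_trans mult_le_mono2)
  then have kt: "k \<le> t" by (simp add: Tt Nk)
  have kT: "2 * k \<le> T" using kt by (simp add: Tt)
  have sT: "s \<le> T" using D N by (metis le_trans mult_le_mono1 nat_mult_1)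
  have kk: "2 * k div 2 = k" by simp
  have e: "expected_closed s T D N = real (s choose N) * (real (t choose k) / real (T choose (2 * k)))"
    using split_weight_eq_binomial[OF T N(1) \<open>D * N \<le> T\<close>]
    unfolding expected_closed_def t_def[symmetric] Nk kk by (rule arg_cong)
  have pos: "real (s choose N) > 0" "real (t choose k) > 0" "real (T choose (2 * k)) > 0"
    using N kt by (simp_all add: Tt)
  then show "expected_closed s T D N > 0" by (simp add: e)
  have ln_e: "ln (expected_closed s T D N) =
      ln (real (s choose N)) + ln (real (t choose k)) - ln (real (T choose (2 * k)))"
    unfolding e using pos by (simp add: ln_mult ln_div)
  have rates: "real n * component_rate D (real s / real n) (real T / real n) (real N / real n) =
      choose_rate (real s) (real N) + choose_rate (real t) (real k) -
        choose_rate (real T) (real (2 * k))"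
  proof -
    have "choose_rate (real s) (real N) =
        real n * choose_rate (real s / real n) (real N / real n)"
      using n N by (subst choose_rate_scale[symmetric]) (auto simp: divide_right_mono)
    moreover have "choose_rate (real t) (real k) =
        real n * choose_rate (real t / real n) (real k / real n)"
      using n kt by (subst choose_rate_scale[symmetric]) (auto simp: divide_right_mono)
    moreover have "choose_rate (real T) (real (2 * k)) = 2 * choose_rate (real t) (real k)"
      using kt by (subst choose_rate_scale[symmetric]) (auto simp: Tt)
    moreover have "real T / real n / 2 = real t / real n" by (simp add: Tt)
    moreover have "real D * (real N / real n) / 2 = real k / real n"
      using Nk by (simp flip: of_nat_mult)
    ultimately show ?thesis
      unfolding component_rate_def by (simp add: algebra_simps)
  qed
  have mono: "ln (real s + 1) \<le> ln (real T + 1)" "ln (real t + 1) \<le> ln (real T + 1)"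
    using sT by (auto simp: Tt)
  have "\<bar>ln (expected_closed s T D N) -
      real n * component_rate D (real s / real n) (real T / real n) (real N / real n)\<bar>
      \<le> 9 * (ln (real T + 1) + 1)"
    using ln_binomial_approx[OF N(2), THEN abs_le_D1] ln_binomial_approx[OF N(2), THEN abs_le_D2]
      ln_binomial_approx[OF kt, THEN abs_le_D1] ln_binomial_approx[OF kt, THEN abs_le_D2]
      ln_binomial_approx[OF kT, THEN abs_le_D1] ln_binomial_approx[OF kT, THEN abs_le_D2] mono
    unfolding ln_e rates by argo
  then have "\<bar>(ln (expected_closed s T D N) -
      real n * component_rate D (real s / real n) (real T / real n) (real N / real n)) / real n\<bar>
      \<le> 9 * (ln (real T + 1) + 1) / real n"
    unfolding abs_divide by (simp add: divide_right_mono)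
  then show "\<bar>ln (expected_closed s T D N) / real n -
      component_rate D (real s / real n) (real T / real n) (real N / real n)\<bar>
      \<le> 9 * (ln (real T + 1) + 1) / real n"
    using n by (simp add: diff_divide_distrib)
qed

lemma component_rate_continuous:
  assumes "\<eta> > 0"
  obtains \<delta> where "\<delta> > 0"
    "\<And>a b x. \<bar>a - a0\<bar> < \<delta> \<Longrightarrow> \<bar>b - b0\<bar> < \<delta> \<Longrightarrow> \<bar>x - x0\<bar> < \<delta> \<Longrightarrow>
      \<bar>component_rate D a b x - component_rate D a0 b0 x0\<bar> < \<eta>"
proof -
  let ?F = "\<lambda>z::real \<times> real \<times> real. component_rate D (fst z) (fst (snd z)) (snd (snd z))"
  have "isCont ?F (a0, b0, x0)"
    unfolding component_rate_def choose_rate_def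
    by (intro continuous_intros isCont_o2[OF _ isCont_phi]) auto
  then obtain r where r: "r > 0"
    "\<And>z. dist z (a0, b0, x0) < r \<Longrightarrow> dist (?F z) (?F (a0, b0, x0)) < \<eta>"
    using assms unfolding continuous_at_eps_delta by blast
  show ?thesis
  proof
    show "r / 3 > 0" using r by simp
    fix a b x
    assume *: "\<bar>a - a0\<bar> < r / 3" "\<bar>b - b0\<bar> < r / 3" "\<bar>x - x0\<bar> < r / 3"
    have "dist (a, b, x) (a0, b0, x0) \<le> \<bar>a - a0\<bar> + (\<bar>b - b0\<bar> + \<bar>x - x0\<bar>)"
      unfolding dist_Pair_Pair dist_real_def
      by (rule order_trans[OF sqrt_sum_squares_le_sum_abs])
        (use sqrt_sum_squares_le_sum_abs[of "b - b0" "x - x0"] in simp)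
    with * have "dist (a, b, x) (a0, b0, x0) < r" by linarith
    from r(2)[OF this] show "\<bar>component_rate D a b x - component_rate D a0 b0 x0\<bar> < \<eta>"
      by (simp add: dist_real_def)
  qed
qed

section \<open>Convergence of the mean degree\<close>

lemma sum_degrees_eq:
  fixes f :: "nat \<Rightarrow> real"
  shows "(\<lambda>k. real (degree_count n d k) * f k) sums (\<Sum>i=1..n. f (d i))"
proof -
  have "(\<Sum>i=1..n. f (d i)) = (\<Sum>k\<in>d ` {1..n}. \<Sum>i | i \<in> {1..n} \<and> d i = k. f (d i))"
    by (rule sum.image_gen) simp
  also have "\<dots> = (\<Sum>k\<in>d ` {1..n}. real (degree_count n d k) * f k)"
    by (rule sum.cong) (simp_all add: degree_count_def)
  finally show ?thesis
    by (simp only:) (rule sums_finite, auto simp: degree_count_def)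
qed

text \<open>
  The contribution of degrees below \<open>K\<close> to the mean degree converges as \<open>n\<close> grows, being a finite
  sum. By the moment bound, degrees of at least \<open>K\<close> contribute at most \<open>B K powr (- e)\<close> uniformly
  in \<open>n\<close>, so that the two limits may be interchanged. The same bounds show that the limiting series
  converges.
\<close>

lemma mean_degree_tendsto:
  fixes d :: "nat \<Rightarrow> nat \<Rightarrow> nat"
  assumes lim: "\<And>k. k \<ge> 1 \<Longrightarrow> (\<lambda>n. real (degree_count n (d n) k) / real n) \<longlonglongrightarrow> p k"
    and nonneg: "\<And>k. p k \<ge> 0"
    and e: "e > 0"
    and bdd: "bdd_above ((\<lambda>n. \<Sum>k. real (degree_count n (d n) k) / real n * real k powr (1 + e)) ` {1..})"
  shows "(\<lambda>n. real (\<Sum>i=1..n. d n i) / real n) \<longlonglongrightarrow> (\<Sum>k. real k * p k)"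
proof -
  obtain B where B: "\<And>n. n \<ge> 1 \<Longrightarrow>
      (\<Sum>k. real (degree_count n (d n) k) / real n * real k powr (1 + e)) \<le> B"
    using bdd unfolding bdd_above_def by auto
  have moment: "(\<Sum>i=1..n. real (d n i) powr (1 + e)) / real n \<le> B" if "n \<ge> 1" for n
  proof -
    have "(\<lambda>k. real (degree_count n (d n) k) / real n * real k powr (1 + e)) sums
        ((\<Sum>i=1..n. real (d n i) powr (1 + e)) / real n)"
      using sums_divide[OF sum_degrees_eq[of n "d n" "\<lambda>k. real k powr (1 + e)"], of "real n"] by simp
    with B[OF that] show ?thesis by (simp add: sums_iff)
  qed
  \<comment> \<open>The contributions of degrees below \<open>K\<close> to the mean degree and to its limit.\<close>
  define c where "c K n = (\<Sum>k<K. real k * (real (degree_count n (d n) k) / real n))" for K n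
  define m where "m K = (\<Sum>k<K. real k * p k)" for K
  let ?t = "\<lambda>n. real (\<Sum>i=1..n. d n i) / real n"
  have c_lim: "c K \<longlonglongrightarrow> m K" for K
    unfolding c_def m_def
  proof (intro tendsto_sum)
    fix k
    show "(\<lambda>n. real k * (real (degree_count n (d n) k) / real n)) \<longlonglongrightarrow> real k * p k"
      by (cases "k = 0") (simp, intro tendsto_mult_left lim, simp)
  qed
  have c_eq: "c K n = (\<Sum>i=1..n. if d n i < K then real (d n i) else 0) / real n" for K n
  proof -
    have "(\<lambda>k. real (degree_count n (d n) k) * (if k < K then real k else 0)) sums
        (\<Sum>i=1..n. if d n i < K then real (d n i) else 0)"
      by (rule sum_degrees_eq)
    moreover have "(\<lambda>k. real (degree_count n (d n) k) * (if k < K then real k else 0)) sums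
        (\<Sum>k<K. real (degree_count n (d n) k) * (if k < K then real k else 0))"
      by (rule sums_finite) auto
    ultimately have "(\<Sum>i=1..n. if d n i < K then real (d n i) else 0) =
        (\<Sum>k<K. real (degree_count n (d n) k) * (if k < K then real k else 0))"
      by (rule sums_unique2)
    also have "\<dots> = (\<Sum>k<K. real k * real (degree_count n (d n) k))"
      by (rule sum.cong) auto
    finally show ?thesis by (simp add: c_def sum_divide_distrib)
  qed
  have tail: "c K n \<le> ?t n" "?t n - c K n \<le> B * real K powr (- e)"
    if K: "K \<ge> 1" and n: "n \<ge> 1" for K n
  proof -
    have diff: "?t n - c K n = (\<Sum>i=1..n. if d n i < K then 0 else real (d n i)) / real n"
      unfolding c_eq of_nat_sum diff_divide_distrib[symmetric] sum_subtractf[symmetric]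
      by (intro arg_cong2[where f = "(/)"] sum.cong) auto
    have "0 \<le> (\<Sum>i=1..n. if d n i < K then 0 else real (d n i)) / real n"
      by (intro divide_nonneg_nonneg sum_nonneg) auto
    with diff show "c K n \<le> ?t n" by linarith
    have "(\<Sum>i=1..n. if d n i < K then 0 else real (d n i)) \<le>
        (\<Sum>i=1..n. real (d n i) powr (1 + e) * real K powr (- e))"
    proof (rule sum_mono)
      fix i
      show "(if d n i < K then 0 else real (d n i)) \<le> real (d n i) powr (1 + e) * real K powr (- e)"
      proof (cases "d n i < K")
        case False
        have "real (d n i) powr (- e) \<le> real K powr (- e)"
          using False K e by (intro powr_mono2') auto
        then have "real (d n i) powr (1 + e) * real (d n i) powr (- e) \<le>
            real (d n i) powr (1 + e) * real K powr (- e)"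
          by (intro mult_left_mono) auto
        moreover have "real (d n i) powr (1 + e) * real (d n i) powr (- e) = real (d n i)"
          using False K by (simp flip: powr_add)
        ultimately show ?thesis using False by simp
      qed simp
    qed
    also have "\<dots> = (\<Sum>i=1..n. real (d n i) powr (1 + e)) * real K powr (- e)"
      by (simp add: sum_distrib_right)
    finally have "?t n - c K n \<le> (\<Sum>i=1..n. real (d n i) powr (1 + e)) * real K powr (- e) / real n"
      unfolding diff by (rule divide_right_mono) simp
    also have "\<dots> = (\<Sum>i=1..n. real (d n i) powr (1 + e)) / real n * real K powr (- e)"
      by simp
    also have "\<dots> \<le> B * real K powr (- e)"
      using moment[OF n] by (rule mult_right_mono) simp
    finally show "?t n - c K n \<le> B * real K powr (- e)" .
  qed
  have t_le: "?t n \<le> B" if "n \<ge> 1" for n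
    using tail(2)[of 1 n] that by (simp add: c_def)
  have "m K \<le> B" for K
  proof (cases "K \<ge> 1")
    case True
    have "c K n \<le> B" if "n \<ge> 1" for n
      by (rule order_trans[OF tail(1)[OF True that] t_le[OF that]])
    then have "\<forall>\<^sub>F n in sequentially. c K n \<le> B" by (rule eventually_sequentiallyI)
    then show ?thesis by (rule tendsto_upperbound[OF c_lim]) simp
  next
    case False
    then have "K = 0" by simp
    then have "m K = 0" by (simp add: m_def)
    moreover have "0 \<le> ?t 1" by simp
    ultimately show ?thesis using t_le[of 1] by linarith
  qed
  then have "summable (\<lambda>k. real k * p k)"
    unfolding m_def by (intro summableI_nonneg_bounded) (auto simp: nonneg)
  then have m_lim: "m \<longlonglongrightarrow> (\<Sum>k. real k * p k)"
    unfolding m_def[abs_def] by (rule summable_LIMSEQ)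
  show ?thesis
  proof (rule LIMSEQ_I)
    fix r :: real
    assume r: "r > 0"
    have "(\<lambda>K. B * real K powr (- e)) \<longlonglongrightarrow> 0"
      using e by real_asymp
    then have "\<forall>\<^sub>F K in sequentially. B * real K powr (- e) < r / 3"
      using r by (intro order_tendstoD) auto
    moreover have "\<forall>\<^sub>F K in sequentially. dist (m K) (\<Sum>k. real k * p k) < r / 3"
      using m_lim r by (intro tendstoD) auto
    ultimately have "\<forall>\<^sub>F K in sequentially. B * real K powr (- e) < r / 3 \<and>
        dist (m K) (\<Sum>k. real k * p k) < r / 3 \<and> K \<ge> 1"
      using eventually_ge_at_top[of 1] by eventually_elim simp
    then obtain K where K: "B * real K powr (- e) < r / 3"
      "dist (m K) (\<Sum>k. real k * p k) < r / 3" "K \<ge> 1"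
      by (auto dest: eventually_happens)
    have "\<forall>\<^sub>F n in sequentially. dist (c K n) (m K) < r / 3"
      using c_lim[of K] r by (intro tendstoD) auto
    then have "\<forall>\<^sub>F n in sequentially. norm (?t n - (\<Sum>k. real k * p k)) < r"
      using eventually_ge_at_top[of 1]
    proof eventually_elim
      case (elim n)
      with tail[OF K(3) elim(2)] K(1,2) show ?case
        unfolding dist_real_def real_norm_def by linarith
    qed
    then show "\<exists>no. \<forall>n\<ge>no. norm (?t n - (\<Sum>k. real k * p k)) < r"
      by (simp add: eventually_sequentially)
  qed
qed

section \<open>The rate of the probability\<close>

text \<open>
  Approximate bounds for small \<open>\<epsilon>\<close> and large \<open>n\<close> settle all four combinations of upper and lower
  limits at once.
\<close>

lemma iterated_limit_eqI:
  fixes g :: "real \<Rightarrow> nat \<Rightarrow> ereal" and L :: real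
  assumes approx: "\<And>\<eta>. \<eta> > 0 \<Longrightarrow> \<forall>\<^sub>F \<epsilon> in at_right 0. \<forall>\<^sub>F n in sequentially.
      ereal (L - \<eta>) \<le> g \<epsilon> n \<and> g \<epsilon> n \<le> ereal (L + \<eta>)"
    and outer: "outer_lim \<in> {Limsup, Liminf}" and inner: "inner_lim \<in> {Limsup, Liminf}"
  shows "outer_lim (at_right (0::real)) (\<lambda>\<epsilon>. inner_lim sequentially (g \<epsilon>)) = ereal L"
proof -
  have between: "ereal a \<le> lim F f \<and> lim F f \<le> ereal b"
    if "lim \<in> {Limsup, Liminf}" "F \<noteq> bot" "\<forall>\<^sub>F x in F. ereal a \<le> f x \<and> f x \<le> ereal b"
    for lim :: "'b filter \<Rightarrow> ('b \<Rightarrow> ereal) \<Rightarrow> ereal" and F f a b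
  proof -
    have l: "ereal a \<le> Liminf F f"
      by (rule Liminf_bounded) (use that(3) in eventually_elim, simp)
    have u: "Limsup F f \<le> ereal b"
      by (rule Limsup_bounded) (use that(3) in eventually_elim, simp)
    have lu: "Liminf F f \<le> Limsup F f" by (rule Liminf_le_Limsup[OF that(2)])
    show ?thesis
    proof (cases "lim = Limsup")
      case True
      show ?thesis unfolding True using order_trans[OF l lu] u ..
    next
      case False
      with that(1) have "lim = Liminf" by simp
      then show ?thesis using l order_trans[OF lu u] by simp
    qed
  qed
  have bounds: "ereal (L - \<eta>) \<le> outer_lim (at_right 0) (\<lambda>\<epsilon>. inner_lim sequentially (g \<epsilon>)) \<and>
      outer_lim (at_right 0) (\<lambda>\<epsilon>. inner_lim sequentially (g \<epsilon>)) \<le> ereal (L + \<eta>)" if "\<eta> > 0" for \<eta>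
  proof (rule between[OF outer])
    show "\<forall>\<^sub>F \<epsilon> in at_right 0. ereal (L - \<eta>) \<le> inner_lim sequentially (g \<epsilon>) \<and>
        inner_lim sequentially (g \<epsilon>) \<le> ereal (L + \<eta>)"
      using approx[OF that]
    proof eventually_elim
      case (elim \<epsilon>)
      show ?case by (rule between[OF inner _ elim]) simp
    qed
  qed simp
  show ?thesis
  proof (rule antisym)
    show "outer_lim (at_right 0) (\<lambda>\<epsilon>. inner_lim sequentially (g \<epsilon>)) \<le> ereal L"
    proof (rule ereal_le_epsilon2)
      fix \<eta> :: real
      assume "\<eta> > 0"
      then show "outer_lim (at_right 0) (\<lambda>\<epsilon>. inner_lim sequentially (g \<epsilon>)) \<le> ereal L + ereal \<eta>"
        using bounds by simp
    qed
    have "ereal L \<le> outer_lim (at_right 0) (\<lambda>\<epsilon>. inner_lim sequentially (g \<epsilon>)) + ereal \<eta>"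
      if "\<eta> > 0" for \<eta>
    proof -
      have "ereal L = ereal (L - \<eta>) + ereal \<eta>" by simp
      also have "\<dots> \<le> outer_lim (at_right 0) (\<lambda>\<epsilon>. inner_lim sequentially (g \<epsilon>)) + ereal \<eta>"
        by (rule add_right_mono) (use bounds[OF that] in blast)
      finally show ?thesis .
    qed
    then show "ereal L \<le> outer_lim (at_right 0) (\<lambda>\<epsilon>. inner_lim sequentially (g \<epsilon>))"
      by (rule ereal_le_epsilon2)
  qed
qed

lemma degree_count_mult_le: "D * degree_count n d D \<le> (\<Sum>i=1..n. d i)"
proof -
  have "D * degree_count n d D = (\<Sum>i | i \<in> {1..n} \<and> d i = D. d i)"
    by (simp add: degree_count_def)
  also have "\<dots> \<le> (\<Sum>i=1..n. d i)" by (rule sum_mono2) auto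
  finally show ?thesis .
qed

lemma degree_count_le: "degree_count n d D \<le> n"
proof -
  have "card {i \<in> {1..n}. d i = D} \<le> card {1..n}" by (rule card_mono) auto
  then show ?thesis by (simp add: degree_count_def)
qed

text \<open>
  Factors \<open>K\<close> that are polynomial in \<open>n\<close> cost only \<open>ln K / n\<close> in the exponential rate.
\<close>

lemma scaled_ext_ln_le:
  assumes n: "n > 0" and K: "K > 0" and P: "P \<le> K * exp (real n * x)"
  shows "ereal (1 / real n) * ext_ln P \<le> ereal (x + ln K / real n)"
proof (cases "P > 0")
  case True
  have "ln P \<le> ln (K * exp (real n * x))" using P True K by (subst ln_le_cancel_iff) auto
  also have "\<dots> = ln K + real n * x" using K by (simp add: ln_mult)
  finally have "1 / real n * ln P \<le> 1 / real n * (ln K + real n * x)"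
    by (rule mult_left_mono) simp
  also have "\<dots> = x + ln K / real n" using n by (simp add: field_simps)
  finally show ?thesis using True by (simp add: ext_ln_def)
next
  case False
  then show ?thesis using n by (simp add: ext_ln_def)
qed

lemma scaled_ext_ln_ge:
  assumes n: "n > 0" and K: "K > 0" and P: "exp (real n * x) \<le> K * P"
  shows "ereal (x - ln K / real n) \<le> ereal (1 / real n) * ext_ln P"
proof -
  have "0 < K * P" using P by (rule less_le_trans[OF exp_gt_zero])
  with K have pos: "P > 0" by (simp add: zero_less_mult_iff)
  have "ln (exp (real n * x)) \<le> ln (K * P)" using P K pos by (subst ln_le_cancel_iff) auto
  also have "\<dots> = ln K + ln P" using K pos by (simp add: ln_mult)
  finally have "real n * x - ln K \<le> ln P" by simp
  then have "1 / real n * (real n * x - ln K) \<le> 1 / real n * ln P"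
    by (rule mult_left_mono) simp
  moreover have "1 / real n * (real n * x - ln K) = x - ln K / real n"
    using n by (simp add: field_simps)
  ultimately show ?thesis using pos by (simp add: ext_ln_def)
qed

lemma log_error_tendsto_0:
  fixes T :: "nat \<Rightarrow> nat"
  assumes T: "(\<lambda>n. real (T n) / real n) \<longlonglongrightarrow> \<mu>"
  shows "(\<lambda>n. 9 * (ln (real (T n) + 1) + 1) / real n) \<longlonglongrightarrow> 0"
proof -
  have mu: "\<mu> \<ge> 0" by (rule tendsto_lowerbound[OF T]) auto
  have "\<forall>\<^sub>F n in sequentially. real (T n) / real n < \<mu> + 1"
    using T by (rule order_tendstoD) simp
  then have upper: "\<forall>\<^sub>F n in sequentially. 9 * (ln (real (T n) + 1) + 1) / real n \<le>
      9 * (ln ((\<mu> + 1) * real n + 1) + 1) / real n"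
    using eventually_gt_at_top[of 0]
  proof eventually_elim
    case (elim n)
    then have "real (T n) \<le> (\<mu> + 1) * real n" by (simp add: field_simps)
    moreover have "real (T n) + 1 > 0" by simp
    ultimately have "ln (real (T n) + 1) \<le> ln ((\<mu> + 1) * real n + 1)"
      by (subst ln_le_cancel_iff) linarith+
    then show ?case by (intro divide_right_mono) auto
  qed
  have lower: "\<forall>\<^sub>F n in sequentially. 0 \<le> 9 * (ln (real (T n) + 1) + 1) / real n"
    by (intro always_eventually allI divide_nonneg_nonneg) (simp_all add: add_nonneg_nonneg)
  have "\<mu> + 1 > 0" using mu by simp
  then have "(\<lambda>n. 9 * (ln ((\<mu> + 1) * real n + 1) + 1) / real n) \<longlonglongrightarrow> 0" by real_asymp
  with lower upper show ?thesis
    by (rule tendsto_sandwich[OF _ _ tendsto_const])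
qed

text \<open>
  For small \<open>\<epsilon>\<close> all sizes in the window have a proportion close to \<open>q\<close>, so by continuity of the
  rate each of the at most \<open>n + 1\<close> expectations in the union bound has almost the rate of \<open>q\<close>.
\<close>

lemma regular_component_upper:
  assumes T: "\<And>n. even (\<Sum>i=1..n. d n i)" and D: "D \<ge> 1"
    and s_lim: "(\<lambda>n. real (degree_count n (d n) D) / real n) \<longlonglongrightarrow> a"
    and T_lim: "(\<lambda>n. real (\<Sum>i=1..n. d n i) / real n) \<longlonglongrightarrow> b"
    and \<eta>: "\<eta> > 0"
  shows "\<forall>\<^sub>F \<epsilon> in at_right 0. \<forall>\<^sub>F n in sequentially.
    ereal (1 / real n) * ext_ln (measure_pmf.prob (configuration_model n (d n))
      (regular_component_event n D q \<epsilon>)) \<le> ereal (component_rate D a b q + \<eta>)"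
proof -
  define s where "s n = degree_count n (d n) D" for n
  define t where "t n = (\<Sum>i=1..n. d n i)" for n
  define L where "L = component_rate D a b q"
  obtain \<delta> where \<delta>: "\<delta> > 0"
    "\<And>a' b' x. \<bar>a' - a\<bar> < \<delta> \<Longrightarrow> \<bar>b' - b\<bar> < \<delta> \<Longrightarrow> \<bar>x - q\<bar> < \<delta> \<Longrightarrow>
      \<bar>component_rate D a' b' x - L\<bar> < \<eta> / 3"
    using component_rate_continuous[of "\<eta> / 3" a b q D] \<eta> unfolding L_def by auto
  have "\<forall>\<^sub>F \<epsilon> in at_right 0. \<epsilon> \<in> {0<..<\<delta>}" using \<delta>(1) by (rule eventually_at_right_real)
  then show ?thesis
  proof eventually_elim
    case (elim \<epsilon>)
    have "\<forall>\<^sub>F n in sequentially. \<bar>real (s n) / real n - a\<bar> < \<delta>"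
      using tendstoD[OF s_lim \<delta>(1)] by (simp add: s_def dist_real_def)
    moreover have "\<forall>\<^sub>F n in sequentially. \<bar>real (t n) / real n - b\<bar> < \<delta>"
      using tendstoD[OF T_lim \<delta>(1)] by (simp add: t_def dist_real_def)
    moreover have "\<forall>\<^sub>F n in sequentially. 9 * (ln (real (t n) + 1) + 1) / real n < \<eta> / 3"
      using log_error_tendsto_0[OF T_lim] \<eta> unfolding t_def by (intro order_tendstoD) auto
    moreover have "\<forall>\<^sub>F n in sequentially. ln (real n + 1) / real n < \<eta> / 3"
    proof -
      have "(\<lambda>n. ln (real n + 1) / real n) \<longlonglongrightarrow> 0" by real_asymp
      then show ?thesis using \<eta> by (intro order_tendstoD) auto
    qed
    ultimately show ?case
      using eventually_gt_at_top[of 0]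
    proof eventually_elim
      case (elim n)
      let ?W = "{N. N \<le> s n \<and> real N \<in> {real n * (q - \<epsilon>)..real n * (q + \<epsilon>)}}"
      let ?B = "exp (real n * (L + 2 * \<eta> / 3))"
      let ?P = "measure_pmf.prob (configuration_model n (d n)) (regular_component_event n D q \<epsilon>)"
      have W: "finite ?W" "card ?W \<le> n + 1"
      proof -
        have "?W \<subseteq> {..n}" using degree_count_le[of n "d n" D] by (auto simp: s_def)
        then show "finite ?W" "card ?W \<le> n + 1"
          using finite_subset card_mono[of "{..n}" ?W] by auto
      qed
      have "expected_closed (s n) (t n) D N \<le> ?B" if N: "N \<in> ?W" for N
      proof (cases "even (D * N)")
        case True
        have t: "even (t n)" using T by (simp add: t_def)
        have Ns: "N \<le> s n" using N by simp
        have Ds: "D * s n \<le> t n" unfolding s_def t_def by (rule degree_count_mult_le)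
        note approx = expected_closed_approx[OF elim(5) t True Ns Ds D]
        have "real n * (q - \<epsilon>) \<le> real N" "real N \<le> real n * (q + \<epsilon>)" using N by auto
        then have "q - \<epsilon> \<le> real N / real n" "real N / real n \<le> q + \<epsilon>"
          using elim(5) by (simp_all add: field_simps)
        with \<open>\<epsilon> \<in> {0<..<\<delta>}\<close> have "\<bar>real N / real n - q\<bar> < \<delta>" by auto
        from \<delta>(2)[OF elim(1,2) this] approx(2) elim(3)
        have "ln (expected_closed (s n) (t n) D N) / real n \<le> L + 2 * \<eta> / 3" by linarith
        then have "ln (expected_closed (s n) (t n) D N) \<le> real n * (L + 2 * \<eta> / 3)"
          using elim(5) by (simp add: pos_divide_le_eq mult.commute)
        then have "exp (ln (expected_closed (s n) (t n) D N)) \<le> ?B" by simp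
        then show ?thesis using approx(1) by simp
      qed (simp add: expected_closed_odd)
      then have "(\<Sum>N\<in>?W. expected_closed (s n) (t n) D N) \<le> real (card ?W) * ?B"
        by (rule sum_bounded_above)
      also have "\<dots> \<le> (real n + 1) * ?B"
        using W(2) by (intro mult_right_mono) auto
      finally have "?P \<le> (real n + 1) * ?B"
        using regular_component_prob_le[OF T[of n], of D q \<epsilon>]
        unfolding s_def t_def by (rule order_trans[rotated])
      then have "ereal (1 / real n) * ext_ln ?P \<le> ereal (L + 2 * \<eta> / 3 + ln (real n + 1) / real n)"
        using elim(5) by (intro scaled_ext_ln_le) auto
      also have "\<dots> \<le> ereal (L + \<eta>)"
        unfolding ereal_less_eq(3) using elim(4) by linarith
      finally show ?case by (simp add: L_def)
    qed
  qed
qed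

text \<open>
  A single size in the window suffices, here for every \<open>\<epsilon>\<close>.
\<close>

lemma regular_component_lower:
  assumes T: "\<And>n. even (\<Sum>i=1..n. d n i)" and D: "D \<ge> 3"
    and s_lim: "(\<lambda>n. real (degree_count n (d n) D) / real n) \<longlonglongrightarrow> a"
    and T_lim: "(\<lambda>n. real (\<Sum>i=1..n. d n i) / real n) \<longlonglongrightarrow> b"
    and q: "0 < q" "q \<le> a" and \<epsilon>: "\<epsilon> > 0" and \<eta>: "\<eta> > 0"
  shows "\<forall>\<^sub>F n in sequentially. ereal (component_rate D a b q - \<eta>) \<le>
    ereal (1 / real n) * ext_ln (measure_pmf.prob (configuration_model n (d n))
      (regular_component_event n D q \<epsilon>))"
proof -
  define s where "s n = degree_count n (d n) D" for n
  define t where "t n = (\<Sum>i=1..n. d n i)" for n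
  define L where "L = component_rate D a b q"
  \<comment> \<open>An even size makes the number of half-edges even; the minimum keeps it at most \<open>s n\<close>, which matters for \<open>q = a\<close>.\<close>
  define N where "N n = 2 * (min (nat \<lfloor>real n * q\<rfloor>) (s n) div 2)" for n
  have N_even: "even (D * N n)" for n by (simp add: N_def)
  have N_le: "N n \<le> s n" for n unfolding N_def by linarith
  have N_lim: "(\<lambda>n. real (N n) / real n) \<longlonglongrightarrow> q"
  proof (rule tendsto_sandwich)
    show "\<forall>\<^sub>F n in sequentially. min q (real (s n) / real n) - 2 / real n \<le> real (N n) / real n"
      using eventually_gt_at_top[of 0]
    proof eventually_elim
      case (elim n)
      have "min (nat \<lfloor>real n * q\<rfloor>) (s n) \<le> N n + 1" unfolding N_def by linarith
      moreover have "real n * q - 1 \<le> real (nat \<lfloor>real n * q\<rfloor>)" by linarith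
      ultimately have "min (real n * q) (real (s n)) - 2 \<le> real (N n)" by linarith
      then have "(min (real n * q) (real (s n)) - 2) / real n \<le> real (N n) / real n"
        by (rule divide_right_mono) simp
      moreover have "min (real n * q) (real (s n)) / real n = min q (real (s n) / real n)"
        using elim by (simp add: min_divide_distrib_right)
      ultimately show ?case by (simp add: diff_divide_distrib)
    qed
    show "\<forall>\<^sub>F n in sequentially. real (N n) / real n \<le> q"
      using eventually_gt_at_top[of 0]
    proof eventually_elim
      case (elim n)
      have "N n \<le> nat \<lfloor>real n * q\<rfloor>" unfolding N_def by linarith
      moreover have "real (nat \<lfloor>real n * q\<rfloor>) \<le> real n * q" using q by simp
      ultimately have "real (N n) \<le> real n * q" by linarith
      with elim show ?case by (simp add: field_simps)
    qed
    have "(\<lambda>n. 2 / real n) \<longlonglongrightarrow> 0" by real_asymp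
    from tendsto_diff[OF tendsto_min[OF tendsto_const s_lim] this, of q]
    show "(\<lambda>n. min q (real (s n) / real n) - 2 / real n) \<longlonglongrightarrow> q"
      using q by (simp add: s_def min_absorb1)
  qed simp
  from eventually_half_connected[OF D, where 'v = nat]
  obtain N1 where N1: "\<forall>N\<ge>N1. \<forall>C (d :: nat \<Rightarrow> nat). finite C \<longrightarrow> card C = N \<longrightarrow> (\<forall>i\<in>C. d i = D) \<longrightarrow>
      num_matchings (D * N) \<le> 2 * card {M \<in> perfect_matchings (stubs d C). matching_connected d C M}"
    unfolding eventually_sequentially by (rule exE)
  obtain \<delta> where \<delta>: "\<delta> > 0"
    "\<And>a' b' x. \<bar>a' - a\<bar> < \<delta> \<Longrightarrow> \<bar>b' - b\<bar> < \<delta> \<Longrightarrow> \<bar>x - q\<bar> < \<delta> \<Longrightarrow>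
      \<bar>component_rate D a' b' x - L\<bar> < \<eta> / 3"
    using component_rate_continuous[of "\<eta> / 3" a b q D] \<eta> unfolding L_def by auto
  have "\<forall>\<^sub>F n in sequentially. \<bar>real (s n) / real n - a\<bar> < \<delta>"
    using tendstoD[OF s_lim \<delta>(1)] by (simp add: s_def dist_real_def)
  moreover have "\<forall>\<^sub>F n in sequentially. \<bar>real (t n) / real n - b\<bar> < \<delta>"
    using tendstoD[OF T_lim \<delta>(1)] by (simp add: t_def dist_real_def)
  moreover have "\<forall>\<^sub>F n in sequentially. 9 * (ln (real (t n) + 1) + 1) / real n < \<eta> / 3"
    using log_error_tendsto_0[OF T_lim] \<eta> unfolding t_def by (intro order_tendstoD) auto
  moreover have "\<forall>\<^sub>F n in sequentially. ln (2 * real n) / real n < \<eta> / 3"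
  proof -
    have "(\<lambda>n. ln (2 * real n) / real n) \<longlonglongrightarrow> 0" by real_asymp
    then show ?thesis using \<eta> by (intro order_tendstoD) auto
  qed
  moreover have "\<forall>\<^sub>F n in sequentially. \<bar>real (N n) / real n - q\<bar> < min \<delta> (min \<epsilon> (q / 2))"
    using tendstoD[OF N_lim, of "min \<delta> (min \<epsilon> (q / 2))"] \<delta>(1) \<epsilon> q by (simp add: dist_real_def)
  moreover have "\<forall>\<^sub>F n in sequentially. real (max 1 N1) < real n * (q / 2)"
  proof -
    have "filterlim (\<lambda>n. real n * (q / 2)) at_top sequentially" using q by real_asymp
    then show ?thesis by (simp add: filterlim_at_top_dense)
  qed
  ultimately show ?thesis
    using eventually_gt_at_top[of 0]
  proof eventually_elim
    case (elim n)
    let ?P = "measure_pmf.prob (configuration_model n (d n)) (regular_component_event n D q \<epsilon>)"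
    let ?e = "expected_closed (s n) (t n) D (N n)"
    have close: "\<bar>real (N n) / real n - q\<bar> < \<delta>" "\<bar>real (N n) / real n - q\<bar> < \<epsilon>"
      "\<bar>real (N n) / real n - q\<bar> < q / 2"
      using elim(5) by auto
    have "q / 2 \<le> real (N n) / real n" "q - \<epsilon> \<le> real (N n) / real n" "real (N n) / real n \<le> q + \<epsilon>"
      using close(2,3) by linarith+
    then have window: "real n * (q / 2) \<le> real (N n)" "real n * (q - \<epsilon>) \<le> real (N n)"
      "real (N n) \<le> real n * (q + \<epsilon>)"
      using elim(7) by (simp_all add: field_simps)
    with elim(6) have "real (max 1 N1) \<le> real (N n)" by linarith
    then have N: "N n \<ge> 1" "N n \<ge> N1" by auto
    have t: "even (t n)" using T by (simp add: t_def)
    have Ds: "D * s n \<le> t n" unfolding s_def t_def by (rule degree_count_mult_le)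
    have "D \<ge> 1" using D by simp
    note approx = expected_closed_approx[OF elim(7) t N_even N_le Ds this]
    from \<delta>(2)[OF elim(1,2) close(1)] approx(2) elim(3)
    have "L - 2 * \<eta> / 3 \<le> ln ?e / real n" by linarith
    then have "real n * (L - 2 * \<eta> / 3) \<le> ln ?e"
      using elim(7) by (simp add: pos_le_divide_eq mult.commute)
    then have "exp (real n * (L - 2 * \<eta> / 3)) \<le> exp (ln ?e)" by simp
    also have "\<dots> = ?e" using approx(1) by simp
    also have "?e \<le> 2 * real n * ?P"
      unfolding s_def t_def
    proof (rule regular_component_prob_ge[OF T])
      show "num_matchings (D * N n) \<le>
          2 * card {M \<in> perfect_matchings (stubs (d n) C). matching_connected (d n) C M}"
        if "C \<subseteq> {1..n}" "card C = N n" "\<forall>i\<in>C. d n i = D" for C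
        using N1[rule_format, OF N(2) finite_subset[OF that(1) finite_atLeastAtMost] that(2)] that(3)
        by simp
    qed (use N window in auto)
    finally have "ereal (L - 2 * \<eta> / 3 - ln (2 * real n) / real n) \<le> ereal (1 / real n) * ext_ln ?P"
      using elim(7) by (intro scaled_ext_ln_ge) auto
    moreover have "ereal (L - \<eta>) \<le> ereal (L - 2 * \<eta> / 3 - ln (2 * real n) / real n)"
      unfolding ereal_less_eq(3) using elim(4) by linarith
    ultimately show ?case unfolding L_def by (rule order_trans[rotated])
  qed
qed

theorem corollary2p11:
  fixes d :: "nat \<Rightarrow> nat \<Rightarrow> nat"
    and p :: "nat pmf"
    and \<epsilon>\<^sub>p \<mu> q :: real
    and D :: nat
  assumes deg_pos: "\<And>n i. i \<in> {1..n} \<Longrightarrow> d n i > 0"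
    and deg_even: "\<And>n. even (\<Sum>i=1..n. d n i)"
    and p_0: "pmf p 0 = 0"
    and degree_limit:
      "\<And>k. k \<ge> 1 \<Longrightarrow>
         (\<lambda>n. real (degree_count n (d n) k) / real n) \<longlonglongrightarrow> pmf p k"
    and eps_p_pos: "\<epsilon>\<^sub>p > 0"
    and moment_bound:
      "bdd_above ((\<lambda>n. \<Sum>k. real (degree_count n (d n) k) / real n
                              * real k powr (1 + \<epsilon>\<^sub>p)) ` {1..})"
    and mu_def: "\<mu> = (\<Sum>k. real k * pmf p k)"
    and p_1: "pmf p 1 = 0"
    and D_ge_3: "D \<ge> 3"
    and p_D_pos: "pmf p D > 0"
    and q_range: "q \<in> {0<..pmf p D}"
  shows "\<forall>outer_lim \<in> {Limsup, Liminf}. \<forall>inner_lim \<in> {Limsup, Liminf}.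
    outer_lim (at_right (0::real)) (\<lambda>\<epsilon>.
      inner_lim sequentially (\<lambda>n.
        ereal (1 / real n) *
          ext_ln (measure_pmf.prob (configuration_model n (d n))
                    (regular_component_event n D q \<epsilon>)))) =
    ereal (- (q * ln q + (pmf p D - q) * ln (pmf p D - q) - pmf p D * ln (pmf p D))
           + (real D * q / 2 * ln (real D * q / 2)
              + (\<mu> - real D * q) / 2 * ln ((\<mu> - real D * q) / 2)
              - \<mu> / 2 * ln (\<mu> / 2)))"
proof (intro ballI)
  fix outer_lim :: "real filter \<Rightarrow> (real \<Rightarrow> ereal) \<Rightarrow> ereal"
    and inner_lim :: "nat filter \<Rightarrow> (nat \<Rightarrow> ereal) \<Rightarrow> ereal"
  assume lims: "outer_lim \<in> {Limsup, Liminf}" "inner_lim \<in> {Limsup, Liminf}"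
  have s_lim: "(\<lambda>n. real (degree_count n (d n) D) / real n) \<longlonglongrightarrow> pmf p D"
    using D_ge_3 by (intro degree_limit) simp
  have T_lim: "(\<lambda>n. real (\<Sum>i=1..n. d n i) / real n) \<longlonglongrightarrow> \<mu>"
    unfolding mu_def by (rule mean_degree_tendsto[OF degree_limit _ eps_p_pos moment_bound]) auto
  have q: "0 < q" "q \<le> pmf p D" using q_range by auto
  \<comment> \<open>Vertices of degree \<open>D\<close> carry at most all half-edges; hence the arguments of \<open>phi\<close> in the rate are nonnegative.\<close>
  have "real D * pmf p D \<le> \<mu>"
  proof (rule tendsto_le[OF _ T_lim tendsto_mult_left[OF s_lim]])
    have "real D * real (degree_count n (d n) D) \<le> real (\<Sum>i=1..n. d n i)" for n
      using of_nat_mono[OF degree_count_mult_le[of D n "d n"], where 'a = real] by simp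
    then have "real D * real (degree_count n (d n) D) / real n \<le> real (\<Sum>i=1..n. d n i) / real n" for n
      by (rule divide_right_mono) simp
    then show "\<forall>\<^sub>F n in sequentially. real D * (real (degree_count n (d n) D) / real n) \<le>
        real (\<Sum>i=1..n. d n i) / real n"
      by simp
  qed simp
  moreover have "real D * q \<le> real D * pmf p D" using q by (intro mult_left_mono) auto
  ultimately have mu: "real D * q \<le> \<mu>" by linarith
  have "0 \<le> real D * q" using q by simp
  with mu have mu0: "0 \<le> \<mu>" by linarith
  have half: "\<mu> / 2 - real D * q / 2 = (\<mu> - real D * q) / 2" by (simp add: diff_divide_distrib)
  have rate: "component_rate D (pmf p D) \<mu> q =
      - (q * ln q + (pmf p D - q) * ln (pmf p D - q) - pmf p D * ln (pmf p D))
           + (real D * q / 2 * ln (real D * q / 2)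
              + (\<mu> - real D * q) / 2 * ln ((\<mu> - real D * q) / 2)
              - \<mu> / 2 * ln (\<mu> / 2))"
    using q mu mu0 unfolding component_rate_def choose_rate_def half
    by (simp add: phi_nonneg)
  show "outer_lim (at_right (0::real)) (\<lambda>\<epsilon>.
      inner_lim sequentially (\<lambda>n.
        ereal (1 / real n) *
          ext_ln (measure_pmf.prob (configuration_model n (d n))
                    (regular_component_event n D q \<epsilon>)))) =
    ereal (- (q * ln q + (pmf p D - q) * ln (pmf p D - q) - pmf p D * ln (pmf p D))
           + (real D * q / 2 * ln (real D * q / 2)
              + (\<mu> - real D * q) / 2 * ln ((\<mu> - real D * q) / 2)
              - \<mu> / 2 * ln (\<mu> / 2)))"
    unfolding rate[symmetric]
  proof (rule iterated_limit_eqI[OF _ lims])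
    fix \<eta> :: real
    assume \<eta>: "\<eta> > 0"
    have "D \<ge> 1" using D_ge_3 by simp
    from regular_component_upper[OF deg_even this s_lim T_lim \<eta>, of q] eventually_at_right_less[of 0]
    show "\<forall>\<^sub>F \<epsilon> in at_right 0. \<forall>\<^sub>F n in sequentially.
        ereal (component_rate D (pmf p D) \<mu> q - \<eta>) \<le> ereal (1 / real n) *
          ext_ln (measure_pmf.prob (configuration_model n (d n)) (regular_component_event n D q \<epsilon>)) \<and>
        ereal (1 / real n) *
          ext_ln (measure_pmf.prob (configuration_model n (d n)) (regular_component_event n D q \<epsilon>)) \<le>
        ereal (component_rate D (pmf p D) \<mu> q + \<eta>)"
    proof eventually_elim
      case (elim \<epsilon>)
      from regular_component_lower[OF deg_even D_ge_3 s_lim T_lim q elim(2) \<eta>] elim(1)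
      show ?case by eventually_elim simp
    qed
  qed
qed

end
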